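(* Let $P, Q \in \mathbb{Z}[z, x_1,\ldots,x_n]$ such that $Q$ is linear in the variables $x_1,\ldots,x_n$. Write $P = \sum_{\boldsymbol{k}} p_{\boldsymbol{k}}(z)\boldsymbol{x}^{\boldsymbol{k}}$ and $Q = \sum_{\boldsymbol{k}} q_{\boldsymbol{k}}(z)\boldsymbol{x}^{\boldsymbol{k}}$ with $p_{\boldsymbol{k}}, q_{\boldsymbol{k}} \in \mathbb{Z}[z]$. Then $P/Q$ has the Gauss property if and only if both of the following hold: $p_{\boldsymbol{k}} \neq 0$ implies $q_{\boldsymbol{k}} \neq 0$; and the univariate rational function $p_{\boldsymbol{k}}/q_{\boldsymbol{k}}$ has the Gauss property for all $\boldsymbol{k}$ with $q_{\boldsymbol{k}} \neq 0$.
   Context: For Laurent polynomials in variables $\boldsymbol{y}=(y_1,\dots,y_N)$ (here either $(z,x_1,\dots,x_n)$ or just $z$): write $\boldsymbol{y}^{\boldsymbol{k}}=y_1^{k_1}\cdots y_N^{k_N}$. For $Q=\sum_{\boldsymbol{k}} q_{\boldsymbol{k}}\boldsymbol{y}^{\boldsymbol{k}}\in\mathbb{Z}[\boldsymbol{y}^{\pm1}]$, its support is the set of $\boldsymbol{k}$ with $q_{\boldsymbol{k}}\ne0$, and $N(Q)$ is the convex hull of the support. For a vertex $\boldsymbol{v}$ of $N(Q)$, expand $\boldsymbol{y}^{\boldsymbol{v}}/Q = \frac{1}{q_{\boldsymbol{v}}}\sum_{m\ge0}\big(-\sum_{\boldsymbol{k}\neq\boldsymbol{v}}\frac{q_{\boldsymbol{k}}}{q_{\boldsymbol{v}}}\boldsymbol{y}^{\boldsymbol{k}-\boldsymbol{v}}\big)^m$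 as a formal Laurent series (well defined, supported in the proper cone generated by $N(Q/\boldsymbol{y}^{\boldsymbol{v}})$) and multiply by $P/\boldsymbol{y}^{\boldsymbol{v}}$; this is the Laurent series expansion of $P/Q$ with respect to $\boldsymbol{v}$. A formal Laurent series $f=\sum f_{\boldsymbol{k}}\boldsymbol{y}^{\boldsymbol{k}}$ with rational coefficients satisfies the Gauss congruences for the prime $p$ if all $f_{\boldsymbol{k}}\in\mathbb{Z}_p$ and $f_{\boldsymbol{m}p^r}\equiv f_{\boldsymbol{m}p^{r-1}}\pmod{p^r}$ for all $\boldsymbol{m}\in\mathbb{Z}^N$, $r\ge1$; it has the Gauss property if this holds for all but finitely many primes. A rational function $P/Q$ ($P,Q\in\mathbb{Z}[\boldsymbol{y}^{\pm1}]$) has the Gauss property if for every vertex $\boldsymbol{v}$ of $N(Q)$ its Laurent series expansion with respect to $\boldsymbol{v}$ has the Gauss property. *)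

theory Defs
  imports
    "HOL-Analysis.Analysis"
    "HOL-Computational_Algebra.Primes"
    "HOL-Library.Poly_Mapping"
    "HOL-Library.Groups_Big_Fun"
begin

section \<open>Laurent polynomials and Newton polytopes\<close>

text \<open>The variables \<open>y\<^sub>i\<close> are indexed by a finite type, and Laurent polynomials
  are the group ring of the lattice of exponent vectors: the ring structure on
  \<open>\<Rightarrow>\<^sub>0\<close> is convolution.\<close>

type_synonym ('a, 'v) laurent_poly = "(int, 'v) vec \<Rightarrow>\<^sub>0 'a"

definition is_polynomial :: "(int, 'v::finite) laurent_poly \<Rightarrow> bool" where
  "is_polynomial P \<longleftrightarrow> (\<forall>k \<in> Poly_Mapping.keys P. \<forall>i. 0 \<le> k $ i)"

definition real_vec :: "int ^ 'v \<Rightarrow> real ^ 'v::finite" where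
  "real_vec k = (\<chi> i. real_of_int (k $ i))"

definition newton_polytope :: "(int, 'v::finite) laurent_poly \<Rightarrow> (real ^ 'v) set" where
  "newton_polytope Q = convex hull (real_vec ` Poly_Mapping.keys Q)"

definition newton_vertex :: "int ^ 'v \<Rightarrow> (int, 'v::finite) laurent_poly \<Rightarrow> bool" where
  "newton_vertex v Q \<longleftrightarrow> real_vec v extreme_point_of newton_polytope Q"


section \<open>Laurent series expansions\<close>

type_synonym 'v laurent_series = "(int, 'v) vec \<Rightarrow> rat"

definition expansion_base ::
    "(int, 'v::finite) laurent_poly \<Rightarrow> int ^ 'v \<Rightarrow> (rat, 'v) laurent_poly" where
  "expansion_base Q v = - (\<Sum>k \<in> Poly_Mapping.keys Q - {v}.
     Poly_Mapping.single (k - v)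
       (rat_of_int (Poly_Mapping.lookup Q k) / rat_of_int (Poly_Mapping.lookup Q v)))"

text \<open>The series \<open>y\<^sup>v / Q\<close>. The sum over \<open>m\<close> has finite support when \<open>v\<close> is a vertex,
  see \<open>finite_expansion_terms\<close> below.\<close>

definition inverse_expansion ::
    "(int, 'v::finite) laurent_poly \<Rightarrow> int ^ 'v \<Rightarrow> 'v laurent_series" where
  "inverse_expansion Q v l =
     1 / rat_of_int (Poly_Mapping.lookup Q v) *
     Sum_any (\<lambda>m::nat. Poly_Mapping.lookup (expansion_base Q v ^ m) l)"

text \<open>The product of \<open>P / y\<^sup>v\<close> with the series \<open>y\<^sup>v / Q\<close>.\<close>

definition laurent_expansion ::
    "(int, 'v::finite) laurent_poly \<Rightarrow> (int, 'v) laurent_poly \<Rightarrow> int ^ 'v \<Rightarrow> 'v laurent_series" where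
  "laurent_expansion P Q v l =
     (\<Sum>k \<in> Poly_Mapping.keys P.
        rat_of_int (Poly_Mapping.lookup P k) * inverse_expansion Q v (l - (k - v)))"


section \<open>The Gauss property\<close>

text \<open>A rational number lies in \<open>\<int>\<^sub>p\<close> iff \<open>p\<close> does not divide its reduced denominator.\<close>

definition p_integral :: "nat \<Rightarrow> rat \<Rightarrow> bool" where
  "p_integral p x \<longleftrightarrow> \<not> int p dvd snd (quotient_of x)"

definition gauss_congruences :: "nat \<Rightarrow> 'v::finite laurent_series \<Rightarrow> bool" where
  "gauss_congruences p f \<longleftrightarrow>
     (\<forall>k. p_integral p (f k)) \<and>
     (\<forall>m. \<forall>r\<ge>1. p_integral p ((f (int (p ^ r) *s m) - f (int (p ^ (r - 1)) *s m)) / of_nat (p ^ r)))"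

definition series_gauss_property :: "'v::finite laurent_series \<Rightarrow> bool" where
  "series_gauss_property f \<longleftrightarrow> finite {p. prime p \<and> \<not> gauss_congruences p f}"

text \<open>The rational function \<open>P / Q\<close> is given by the pair \<open>P\<close>, \<open>Q\<close>; meaningful for \<open>Q \<noteq> 0\<close>.\<close>

definition gauss_property ::
    "(int, 'v::finite) laurent_poly \<Rightarrow> (int, 'v) laurent_poly \<Rightarrow> bool" where
  "gauss_property P Q \<longleftrightarrow>
     (\<forall>v. newton_vertex v Q \<longrightarrow> series_gauss_property (laurent_expansion P Q v))"


section \<open>Polynomials in \<open>z, x\<^sub>1, \<dots>, x\<^sub>n\<close>\<close>

text \<open>The variables \<open>z, x\<^sub>1, \<dots>, x\<^sub>n\<close> are indexed by \<^typ>\<open>'n option\<close> with \<open>n = CARD('n)\<close>: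
  \<^term>\<open>None\<close> stands for \<open>z\<close> and \<^term>\<open>Some i\<close> for \<open>x\<^sub>i\<close>. The single variable \<open>z\<close> on its own
  is indexed by \<^typ>\<open>1\<close>.\<close>

definition zx_exponent :: "int ^ 'n \<Rightarrow> int ^ 1 \<Rightarrow> int ^ ('n::finite) option" where
  "zx_exponent k j = (\<chi> i. case i of None \<Rightarrow> j $ 1 | Some i' \<Rightarrow> k $ i')"

text \<open>\<open>x_coeff P k\<close> is the coefficient \<open>p\<^sub>k(z)\<close> of \<open>x\<^sup>k\<close> in \<open>P\<close>; \<open>map_key\<close> is precomposition on
  exponents for an injective map, see \<open>lookup_x_coeff\<close>.\<close>

definition x_coeff :: "(int, ('n::finite) option) laurent_poly \<Rightarrow> int ^ 'n \<Rightarrow> (int, 1) laurent_poly" where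
  "x_coeff P k = Poly_Mapping.map_key (zx_exponent k) P"

text \<open>Linear in the variables \<open>x\<^sub>1, \<dots>, x\<^sub>n\<close> means degree at most 1 in each \<open>x\<^sub>i\<close> separately, so that
  mixed monomials such as \<open>x\<^sub>1x\<^sub>2\<close> are allowed; there is no condition on the degree in \<open>z\<close>.\<close>

definition linear_in_x :: "(int, ('n::finite) option) laurent_poly \<Rightarrow> bool" where
  "linear_in_x Q \<longleftrightarrow> (\<forall>k \<in> Poly_Mapping.keys Q. \<forall>i. k $ Some i \<le> 1)"


section \<open>Well-definedness\<close>

lemma inj_zx_exponent: "inj (zx_exponent k)"
proof (rule injI)
  fix a b :: "int ^ 1" assume "zx_exponent k a = zx_exponent k b"
  then have "zx_exponent k a $ None = zx_exponent k b $ None" by simp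
  then show "a = b" by (simp add: zx_exponent_def vec_eq_iff)
qed

lemma lookup_x_coeff:
  "Poly_Mapping.lookup (x_coeff P k) j = Poly_Mapping.lookup P (zx_exponent k j)"
  by (simp add: x_coeff_def map_key.rep_eq[OF inj_zx_exponent])

lemma real_vec_add: "real_vec (a + b) = real_vec a + real_vec b"
  and real_vec_diff: "real_vec (a - b) = real_vec a - real_vec b"
  and real_vec_0: "real_vec 0 = 0"
  by (simp_all add: real_vec_def vec_eq_iff)

lemma inj_real_vec: "inj real_vec"
  by (rule injI) (simp add: real_vec_def vec_eq_iff)

lemma newton_vertex_in_keys:
  assumes "newton_vertex v Q"
  shows "v \<in> Poly_Mapping.keys Q"
proof -
  have "real_vec v \<in> real_vec ` Poly_Mapping.keys Q"
    using assms unfolding newton_vertex_def newton_polytope_def by (rule extreme_point_of_convex_hull)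
  then show ?thesis by (simp only: inj_image_mem_iff[OF inj_real_vec])
qed

lemma newton_vertex_functional:
  assumes "newton_vertex v Q"
  shows "\<exists>(a :: real ^ 'v::finite) e. e > 0 \<and>
    (\<forall>k \<in> Poly_Mapping.keys Q - {v}. e \<le> a \<bullet> real_vec (k - v))"
proof -
  define T where "T = real_vec ` (Poly_Mapping.keys Q - {v})"
  have fin: "finite T" by (simp add: T_def)
  have "convex (newton_polytope Q - {real_vec v})"
    using assms by (simp add: newton_vertex_def extreme_point_of_stillconvex newton_polytope_def)
  moreover have "T \<subseteq> newton_polytope Q - {real_vec v}"
    using inj_real_vec by (auto simp: T_def newton_polytope_def inj_def intro!: hull_inc)
  ultimately have "convex hull T \<subseteq> newton_polytope Q - {real_vec v}"
    by (metis hull_minimal)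
  then have "real_vec v \<notin> convex hull T" by blast
  moreover have "closed (convex hull T)"
    using fin by (simp add: finite_imp_compact_convex_hull compact_imp_closed)
  ultimately obtain a b where ab: "a \<bullet> real_vec v < b" "\<forall>x\<in>convex hull T. a \<bullet> x > b"
    using separating_hyperplane_closed_point[of "convex hull T" "real_vec v"] convex_convex_hull by blast
  have "b - a \<bullet> real_vec v \<le> a \<bullet> real_vec (k - v)" if "k \<in> Poly_Mapping.keys Q - {v}" for k
  proof -
    have "real_vec k \<in> convex hull T" using that by (auto simp: T_def intro!: hull_inc)
    then show ?thesis using ab by (force simp: real_vec_diff inner_diff_right)
  qed
  moreover have "b - a \<bullet> real_vec v > 0" using ab by simp
  ultimately show ?thesis by blast
qed

lemma keys_uminus: "Poly_Mapping.keys (- f) = Poly_Mapping.keys (f :: 'b \<Rightarrow>\<^sub>0 'a::ab_group_add)"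
  by (auto simp: in_keys_iff)

lemma keys_expansion_base:
  "Poly_Mapping.keys (expansion_base Q v) \<subseteq> (\<lambda>k. k - v) ` (Poly_Mapping.keys Q - {v})"
proof -
  have "Poly_Mapping.keys (expansion_base Q v) \<subseteq>
    (\<Union>k\<in>Poly_Mapping.keys Q - {v}. Poly_Mapping.keys (Poly_Mapping.single (k - v)
       (rat_of_int (Poly_Mapping.lookup Q k) / rat_of_int (Poly_Mapping.lookup Q v))))"
    unfolding expansion_base_def by (simp only: keys_uminus) (rule keys_sum)
  also have "\<dots> \<subseteq> (\<lambda>k. k - v) ` (Poly_Mapping.keys Q - {v})"
    by (auto split: if_splits)
  finally show ?thesis .
qed

lemma finite_expansion_terms:
  assumes "newton_vertex v Q"
  shows "finite {m. Poly_Mapping.lookup (expansion_base Q v ^ m) l \<noteq> 0}"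
proof -
  obtain a e where e: "e > 0"
    and a: "\<forall>k \<in> Poly_Mapping.keys Q - {v}. e \<le> a \<bullet> real_vec (k - v)"
    using newton_vertex_functional[OF assms] by blast
  have bound: "real m * e \<le> a \<bullet> real_vec j"
    if "j \<in> Poly_Mapping.keys (expansion_base Q v ^ m)" for m j
    using that
  proof (induction m arbitrary: j)
    case 0
    then show ?case by (simp add: real_vec_0)
  next
    case (Suc m)
    then have "j \<in> Poly_Mapping.keys (expansion_base Q v * expansion_base Q v ^ m)" by simp
    then obtain b c where bc: "j = b + c" "b \<in> Poly_Mapping.keys (expansion_base Q v)"
      "c \<in> Poly_Mapping.keys (expansion_base Q v ^ m)"
      using keys_mult by blast
    have "e \<le> a \<bullet> real_vec b" using bc(2) keys_expansion_base[of Q v] a by blast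
    then show ?case using Suc.IH[OF bc(3)] bc(1)
      by (simp add: real_vec_add inner_add_right algebra_simps)
  qed
  have "{m. Poly_Mapping.lookup (expansion_base Q v ^ m) l \<noteq> 0} \<subseteq> {..nat \<lceil>a \<bullet> real_vec l / e\<rceil>}"
  proof safe
    fix m assume "Poly_Mapping.lookup (expansion_base Q v ^ m) l \<noteq> 0"
    then have "real m * e \<le> a \<bullet> real_vec l" by (intro bound) (simp add: in_keys_iff)
    then have "real m \<le> a \<bullet> real_vec l / e" using e by (simp add: field_simps)
    then show "m \<le> nat \<lceil>a \<bullet> real_vec l / e\<rceil>" by linarith
  qed
  then show ?thesis using finite_subset by blast
qed

end

theory Submission
  imports
    Defs
    "HOL-Computational_Algebra.Formal_Laurent_Series"
begin

no_notation fps_nth (infixl "$" 75)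
notation fls_nth (infixl "$$" 75)

text \<open>For the forward direction, if some \<open>x\<close>-exponent of \<open>P\<close> were missing in \<open>Q\<close>, a generic
  functional would give an expansion whose lowest exponent \<open>u\<close> is negative; then \<open>p u\<close> is outside the
  support, so \<open>p\<close> divides a fixed nonzero rational for almost all \<open>p\<close>. Next, every exponent
  of \<open>Q\<close> in \<open>x\<close> is a vertex of the unit cube, so the terms over it form a face of \<open>N(Q)\<close>, and
  restricting an expansion of \<open>P/Q\<close> to that face yields one of \<open>p\<^sub>k/q\<^sub>k\<close>.

  For the converse, choose a generic functional selecting the given vertex and let
  \<open>P = p\<^sub>k x\<^sup>k\<close>. Splitting \<open>Q = Q\<^sub>1 + Q\<^sub>2\<close> by the exponent of one \<open>x\<^sub>i\<close>, with the
  vertex in \<open>Q\<^sub>1\<close>, and putting \<open>W = - Q\<^sub>2/Q\<^sub>1\<close>, one has \<open>P/Q = G/(1 - W)\<close> with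
  \<open>G = P/Q\<^sub>1\<close>, or \<open>P/Q = G - G/(1 - W)\<close> with \<open>G = P/Q\<^sub>2\<close>. Here \<open>G\<close> is free
  of \<open>x\<^sub>i\<close> and \<open>W\<close> has degree \<open>\<plusminus>1\<close> in \<open>x\<^sub>i\<close>, so the coefficients of \<open>G/(1 - W)\<close>
  are those of the \<open>G W\<^sup>m\<close>, and the Gauss congruences pass from \<open>G\<close> to \<open>G/(1 - W)\<close> because
  \<open>w\<close> raised to \<open>p\<^sup>r\<close> agrees modulo \<open>p\<^sup>r\<close> with its Frobenius twist \<open>\<Phi>(w)\<close> raised to
  \<open>p\<^sup>r\<^sup>-\<^sup>1\<close>. Induction on the number of terms of \<open>Q\<close> ends at \<open>p\<^sub>k/q\<^sub>k\<close>.\<close>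

section \<open>Denominators prime to \<open>p\<close>\<close>

text \<open>The reduced denominator divides every other denominator of the same fraction. Hence any
  representation with denominator prime to \<open>p\<close> certifies integrality, and the closure
  lemmas below may simply multiply denominators.\<close>

lemma p_integral_iff:
  assumes "prime p"
  shows "p_integral p x \<longleftrightarrow> (\<exists>a b. x = rat_of_int a / rat_of_int b \<and> \<not> int p dvd b)"
proof
  assume "p_integral p x"
  moreover obtain a b where "quotient_of x = (a, b)" by fastforce
  ultimately show "\<exists>a b. x = rat_of_int a / rat_of_int b \<and> \<not> int p dvd b"
    using quotient_of_div unfolding p_integral_def by fastforce
next
  assume "\<exists>a b. x = rat_of_int a / rat_of_int b \<and> \<not> int p dvd b"
  then obtain a b where ab: "x = rat_of_int a / rat_of_int b" "\<not> int p dvd b" by blast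
  then have b0: "b \<noteq> 0" by auto
  obtain c d where cd: "quotient_of x = (c, d)" by fastforce
  have d0: "d > 0" using quotient_of_denom_pos[OF cd] .
  have "rat_of_int a / rat_of_int b = rat_of_int c / rat_of_int d"
    using quotient_of_div[OF cd] ab by simp
  then have "rat_of_int (a * d) = rat_of_int (c * b)"
    using b0 d0 by (simp add: field_simps)
  then have "a * d = c * b" by (simp only: of_int_eq_iff)
  then have "d dvd c * b" by (metis dvd_triv_right)
  then have "d dvd b" using quotient_of_coprime[OF cd]
    by (simp add: coprime_commute coprime_dvd_mult_right_iff)
  then show "p_integral p x"
    using ab(2) cd by (auto simp: p_integral_def dest: dvd_trans)
qed

context
  fixes p :: nat
  assumes p: "prime p"
begin

lemma p_integral_of_int [simp]: "p_integral p (rat_of_int a)"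
  using p prime_gt_1_nat[OF p] by (auto simp: p_integral_def)

lemma p_integral_0 [simp]: "p_integral p 0"
  using p_integral_of_int[of 0] by simp

lemma p_integral_1 [simp]: "p_integral p 1"
  using p_integral_of_int[of 1] by simp

lemma p_integral_of_nat [simp]: "p_integral p (rat_of_nat n)"
  using p_integral_of_int[of "int n"] by simp

lemma p_integral_mult:
  assumes "p_integral p x" "p_integral p y"
  shows "p_integral p (x * y)"
proof -
  obtain a b c d where ab: "x = rat_of_int a / rat_of_int b" "\<not> int p dvd b"
    and cd: "y = rat_of_int c / rat_of_int d" "\<not> int p dvd d"
    using assms p_integral_iff[OF p] by metis
  have "x * y = rat_of_int (a * c) / rat_of_int (b * d)" using ab cd by simp
  moreover have "\<not> int p dvd b * d" using ab cd p by (simp add: prime_dvd_mult_iff)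
  ultimately show ?thesis using p_integral_iff[OF p] by blast
qed

lemma p_integral_add:
  assumes "p_integral p x" "p_integral p y"
  shows "p_integral p (x + y)"
proof -
  obtain a b c d where ab: "x = rat_of_int a / rat_of_int b" "\<not> int p dvd b"
    and cd: "y = rat_of_int c / rat_of_int d" "\<not> int p dvd d"
    using assms p_integral_iff[OF p] by metis
  have "b \<noteq> 0" "d \<noteq> 0" using ab cd by auto
  then have "x + y = rat_of_int (a * d + c * b) / rat_of_int (b * d)"
    using ab cd by (simp add: field_simps)
  moreover have "\<not> int p dvd b * d" using ab cd p by (simp add: prime_dvd_mult_iff)
  ultimately show ?thesis using p_integral_iff[OF p] by blast
qed

lemma p_integral_uminus: "p_integral p x \<Longrightarrow> p_integral p (- x)"
  using p_integral_mult[OF p_integral_of_int[of "- 1"], of x] by simp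

lemma p_integral_sum: "(\<And>i. i \<in> A \<Longrightarrow> p_integral p (f i)) \<Longrightarrow> p_integral p (sum f A)"
  by (induction A rule: infinite_finite_induct) (auto intro: p_integral_add)

lemma p_integral_divide_of_int:
  assumes "p_integral p x" "\<not> int p dvd b"
  shows "p_integral p (x / rat_of_int b)"
proof -
  have "p_integral p (rat_of_int 1 / rat_of_int b)" using p_integral_iff[OF p] assms(2) by blast
  then show ?thesis using p_integral_mult[OF assms(1)] by fastforce
qed

lemma p_integral_power_divide_mono:
  assumes "p_integral p (x / of_nat (p ^ s))" "r \<le> s"
  shows "p_integral p (x / of_nat (p ^ r))"
proof -
  have "x / of_nat (p ^ r) = rat_of_nat (p ^ (s - r)) * (x / of_nat (p ^ s))"
    using p prime_gt_0_nat[OF p] assms(2) power_add[of "rat_of_nat p" r "s - r"]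
    by (simp add: field_simps)
  then show ?thesis using p_integral_mult[OF p_integral_of_nat assms(1)] by metis
qed

end

section \<open>Convolution formulas with freely chosen finite index sets\<close>

lemma lookup_times:
  fixes f g :: "('b :: ab_group_add) \<Rightarrow>\<^sub>0 ('a :: comm_ring_1)"
  assumes "finite A" "Poly_Mapping.keys g \<subseteq> A"
  shows "Poly_Mapping.lookup (f * g) l =
    (\<Sum>k\<in>A. Poly_Mapping.lookup f (l - k) * Poly_Mapping.lookup g k)"
proof -
  have "Poly_Mapping.lookup (f * g) l = Poly_Mapping.lookup (g * f) l" by (simp add: mult.commute)
  also have "\<dots> = Sum_any (\<lambda>k. Poly_Mapping.lookup g k * Poly_Mapping.lookup f (l - k))"
  proof -
    have "(\<lambda>q. Poly_Mapping.lookup f q when l = k + q) = (\<lambda>q. Poly_Mapping.lookup f q when q = l - k)"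
      for k by (auto simp: fun_eq_iff when_def)
    then have "Sum_any (\<lambda>q. Poly_Mapping.lookup f q when l = k + q) = Poly_Mapping.lookup f (l - k)"
      for k by (simp only: Sum_any_when_equal)
    then show ?thesis by (simp only: lookup_mult)
  qed
  also have "\<dots> = (\<Sum>k\<in>A. Poly_Mapping.lookup g k * Poly_Mapping.lookup f (l - k))"
    using assms by (intro Sum_any.expand_superset) (auto simp: in_keys_iff subset_iff, metis mult_zero_left)
  finally show ?thesis by (simp add: mult.commute)
qed

text \<open>Any finite \<open>J\<close> catching the nonzero products will do, not only an interval;
  this permits summing over multiples of \<open>p\<close> when a factor is a \<open>frob\<close>
  image.\<close>

lemma fls_times_nth_superset:
  fixes f g :: "('a :: comm_ring_1) fls"
  assumes "finite J" "\<And>j. f $$ (n - j) \<noteq> 0 \<Longrightarrow> g $$ j \<noteq> 0 \<Longrightarrow> j \<in> J"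
  shows "(f * g) $$ n = (\<Sum>j\<in>J. f $$ (n - j) * g $$ j)"
proof -
  have "(f * g) $$ n = (g * f) $$ n" by (simp add: mult.commute)
  also have "\<dots> = (\<Sum>j=fls_subdegree g..n - fls_subdegree f. g $$ j * f $$ (n - j))"
    by (rule fls_times_nth(2))
  also have "\<dots> = (\<Sum>j\<in>J \<union> {fls_subdegree g..n - fls_subdegree f}. g $$ j * f $$ (n - j))"
  proof (rule sum.mono_neutral_left)
    show "\<forall>j\<in>J \<union> {fls_subdegree g..n - fls_subdegree f} - {fls_subdegree g..n - fls_subdegree f}.
        g $$ j * f $$ (n - j) = 0"
      using fls_eq0_below_subdegree[of _ g] fls_eq0_below_subdegree[of _ f]
      by (smt (verit, best) DiffD2 atLeastAtMost_iff mult_zero_left mult_zero_right)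
  qed (use assms in auto)
  also have "\<dots> = (\<Sum>j\<in>J. g $$ j * f $$ (n - j))"
    using assms by (intro sum.mono_neutral_right) (auto, metis mult_zero_left mult_zero_right)
  finally show ?thesis by (simp add: mult.commute)
qed

section \<open>Substitution of powers and the Cartier operator on Laurent polynomials\<close>

definition pm_frob :: "int \<Rightarrow> (rat, 'v::finite) laurent_poly \<Rightarrow> (rat, 'v) laurent_poly" where
  "pm_frob d f = (\<Sum>k\<in>Poly_Mapping.keys f. Poly_Mapping.single (d *s k) (Poly_Mapping.lookup f k))"

text \<open>The Cartier operator: exponents divisible by \<open>d\<close> are kept and divided by
  \<open>d\<close>.\<close>

definition pm_cartier :: "int \<Rightarrow> (rat, 'v::finite) laurent_poly \<Rightarrow> (rat, 'v) laurent_poly" where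
  "pm_cartier d f = Poly_Mapping.map_key ((*s) d) f"

lemma vec_scale_cancel [simp]:
  fixes k l :: "int ^ 'v"
  assumes "d \<noteq> 0"
  shows "d *s k = d *s l \<longleftrightarrow> k = l"
  using assms by (simp add: vec_eq_iff)

lemma inj_vec_scale: "d \<noteq> 0 \<Longrightarrow> inj ((*s) (d :: int) :: int ^ 'v \<Rightarrow> int ^ 'v)"
  by (auto simp: inj_def)

context
  fixes d :: int
  assumes d: "d \<noteq> 0"
begin

lemma lookup_pm_cartier [simp]:
  "Poly_Mapping.lookup (pm_cartier d f) k = Poly_Mapping.lookup f (d *s k)"
  by (simp add: pm_cartier_def map_key.rep_eq[OF inj_vec_scale[OF d]])

lemma lookup_pm_frob [simp]:
  "Poly_Mapping.lookup (pm_frob d f) (d *s k) = Poly_Mapping.lookup f k"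
  using d by (simp add: pm_frob_def lookup_sum lookup_single when_def in_keys_iff)

lemma lookup_pm_frob_eq_0:
  "\<forall>k. l \<noteq> d *s k \<Longrightarrow> Poly_Mapping.lookup (pm_frob d f) l = 0"
  by (auto simp: pm_frob_def lookup_sum lookup_single when_def intro!: sum.neutral)

lemma pm_frob_eqI:
  assumes "\<And>k. Poly_Mapping.lookup g (d *s k) = Poly_Mapping.lookup f k"
    and "\<And>l. \<forall>k. l \<noteq> d *s k \<Longrightarrow> Poly_Mapping.lookup g l = 0"
  shows "pm_frob d f = g"
proof (rule poly_mapping_eqI)
  fix l
  show "Poly_Mapping.lookup (pm_frob d f) l = Poly_Mapping.lookup g l"
    by (cases "\<exists>k. l = d *s k") (use assms lookup_pm_frob_eq_0 in auto)
qed

lemma keys_pm_frob: "Poly_Mapping.keys (pm_frob d f) = (*s) d ` Poly_Mapping.keys f"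
proof -
  have "l \<in> Poly_Mapping.keys (pm_frob d f) \<longleftrightarrow> l \<in> (*s) d ` Poly_Mapping.keys f" for l
  proof (cases "\<exists>k. l = d *s k")
    case True
    then show ?thesis using d by (auto simp: in_keys_iff image_iff)
  next
    case False
    then show ?thesis using lookup_pm_frob_eq_0[of l f] by (auto simp: in_keys_iff)
  qed
  then show ?thesis by blast
qed

lemma pm_frob_add: "pm_frob d (f + g) = pm_frob d f + pm_frob d g"
  by (rule pm_frob_eqI) (simp_all add: lookup_add lookup_pm_frob_eq_0)

lemma pm_frob_0 [simp]: "pm_frob d 0 = 0"
  by (simp add: pm_frob_def)

lemma pm_frob_sum: "pm_frob d (sum f A) = (\<Sum>i\<in>A. pm_frob d (f i))"
  by (induction A rule: infinite_finite_induct) (simp_all add: pm_frob_add)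

lemma pm_frob_single: "pm_frob d (Poly_Mapping.single k c) = Poly_Mapping.single (d *s k) c"
  by (simp add: pm_frob_def)

lemma pm_cartier_add: "pm_cartier d (f + g) = pm_cartier d f + pm_cartier d g"
  by (rule poly_mapping_eqI) (simp add: lookup_add)

lemma pm_cartier_0 [simp]: "pm_cartier d 0 = 0"
  by (rule poly_mapping_eqI) simp

lemma pm_cartier_sum: "pm_cartier d (sum f A) = (\<Sum>i\<in>A. pm_cartier d (f i))"
  by (induction A rule: infinite_finite_induct) (simp_all add: pm_cartier_add)

lemma lookup_times_pm_frob:
  "Poly_Mapping.lookup (f * pm_frob d g) l =
    (\<Sum>k\<in>Poly_Mapping.keys g. Poly_Mapping.lookup f (l - d *s k) * Poly_Mapping.lookup g k)"
proof -
  have "inj_on ((*s) d) (Poly_Mapping.keys g)" using inj_vec_scale[OF d] inj_on_subset by blast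
  then show ?thesis
    by (simp add: lookup_times[OF finite_keys order_refl] keys_pm_frob sum.reindex)
qed

text \<open>Projection formula: the exponents of \<open>pm_frob d g\<close> are multiples of
  \<open>d\<close>, so a product exponent is a multiple of \<open>d\<close> exactly when the
  exponent from \<open>f\<close> is.\<close>

lemma pm_cartier_times_frob: "pm_cartier d (f * pm_frob d g) = pm_cartier d f * g"
  by (rule poly_mapping_eqI)
    (simp add: lookup_times_pm_frob lookup_times[of "Poly_Mapping.keys g"] vector_ssub_ldistrib)

lemma pm_cartier_frob: "pm_cartier d (pm_frob d f) = f"
  by (rule poly_mapping_eqI) simp

text \<open>At multiples of \<open>d\<close> this is the projection formula together with
  \<open>pm_cartier_frob\<close>. Elsewhere both sides vanish, as subtracting a multiple of
  \<open>d\<close> from a non-multiple leaves a non-multiple.\<close>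

lemma pm_frob_mult:
  fixes f g :: "(rat, 'v::finite) laurent_poly"
  shows "pm_frob d (f * g) = pm_frob d f * pm_frob d g"
proof (rule pm_frob_eqI)
  fix k
  have "Poly_Mapping.lookup (pm_frob d f * pm_frob d g) (d *s k) =
      Poly_Mapping.lookup (pm_cartier d (pm_frob d f * pm_frob d g)) k" by simp
  also have "\<dots> = Poly_Mapping.lookup (f * g) k"
    by (simp only: pm_cartier_times_frob pm_cartier_frob)
  finally show "Poly_Mapping.lookup (pm_frob d f * pm_frob d g) (d *s k) =
      Poly_Mapping.lookup (f * g) k" .
next
  fix l :: "int ^ 'v" assume l: "\<forall>k. l \<noteq> d *s k"
  have "Poly_Mapping.lookup (pm_frob d f) (l - d *s k) = 0" for k
  proof (rule lookup_pm_frob_eq_0, rule allI)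
    fix m show "l - d *s k \<noteq> d *s m"
      using l[rule_format, of "m + k"] by (auto simp: vector_add_ldistrib algebra_simps)
  qed
  then show "Poly_Mapping.lookup (pm_frob d f * pm_frob d g) l = 0"
    by (simp add: lookup_times_pm_frob)
qed

end

text \<open>Laurent series in an auxiliary variable \<open>t\<close> over the Laurent polynomials. Below, an integral
  functional \<open>a\<close> turns \<open>y\<^sup>k\<close> into \<open>y\<^sup>k\<close> times \<open>t\<close> to the power \<open>a \<bullet> k\<close>, so that all expansions
  with respect to vertices selected by \<open>a\<close> live in this one ring.\<close>

type_synonym 'v lseries = "(rat, 'v) laurent_poly fls"

text \<open>The ring endomorphism substituting \<open>p\<close>-th powers for all variables, and its left inverse, which
  keeps the exponents divisible by \<open>p\<close>.\<close>

definition frob :: "nat \<Rightarrow> 'v::finite lseries \<Rightarrow> 'v lseries" where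
  "frob p f = Abs_fls (\<lambda>n. if int p dvd n then pm_frob (int p) (f $$ (n div int p)) else 0)"

definition cartier :: "nat \<Rightarrow> 'v::finite lseries \<Rightarrow> 'v lseries" where
  "cartier p f = Abs_fls (\<lambda>n. pm_cartier (int p) (f $$ (int p * n)))"

context
  fixes p :: nat
  assumes p: "p > 0"
begin

lemma frob_nth_full:
  "frob p f $$ n = (if int p dvd n then pm_frob (int p) (f $$ (n div int p)) else 0)"
  unfolding frob_def
proof (rule nth_Abs_fls_ex_lower_bound, intro exI allI impI)
  \<comment> \<open>\<open>Abs_fls\<close> needs a bound below which coefficients vanish; the
    absolute value covers either sign of the subdegree.\<close>
  fix n assume n: "n < - \<bar>int p * fls_subdegree f\<bar>"
  have "n div int p < fls_subdegree f" if "int p dvd n"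
  proof -
    have "int p * (n div int p) < int p * fls_subdegree f" using n that by auto
    then show ?thesis using p by simp
  qed
  then show "(if int p dvd n then pm_frob (int p) (f $$ (n div int p)) else 0) = 0"
    using p by (simp add: pm_frob_def)
qed

lemma frob_nth [simp]: "frob p f $$ (int p * n) = pm_frob (int p) (f $$ n)"
  using p by (simp add: frob_nth_full)

lemma frob_nth_eq_0: "\<not> int p dvd n \<Longrightarrow> frob p f $$ n = 0"
  by (simp add: frob_nth_full)

lemma cartier_nth [simp]: "cartier p f $$ n = pm_cartier (int p) (f $$ (int p * n))"
  unfolding cartier_def
proof (rule nth_Abs_fls_ex_lower_bound, intro exI allI impI)
  fix n assume n: "n < - \<bar>fls_subdegree f\<bar>"
  \<comment> \<open>Here \<open>n\<close> is negative, so multiplying by \<open>p\<close> moves it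
    further below the subdegree.\<close>
  have "int p * n \<le> n"
    using p n mult_right_mono_neg[of 1 "int p" n] by (auto)
  then show "pm_cartier (int p) (f $$ (int p * n)) = 0"
    using p n by simp
qed

lemma frob_eqI:
  assumes "\<And>n. g $$ (int p * n) = pm_frob (int p) (f $$ n)" "\<And>n. \<not> int p dvd n \<Longrightarrow> g $$ n = 0"
  shows "frob p f = g"
proof (rule fls_eqI)
  fix n show "frob p f $$ n = g $$ n"
    by (cases "int p dvd n") (use assms frob_nth_eq_0 in auto)
qed

lemma frob_add: "frob p (f + g) = frob p f + frob p g"
  using p by (intro frob_eqI) (simp_all add: pm_frob_add frob_nth_eq_0)

lemma frob_1 [simp]: "frob p 1 = 1"
  using p pm_frob_single[of "int p" 0 1]
  by (intro frob_eqI) (auto)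

lemma times_frob_nth:
  assumes "finite J" "\<And>j. f $$ (n - int p * j) \<noteq> 0 \<Longrightarrow> g $$ j \<noteq> 0 \<Longrightarrow> j \<in> J"
  shows "(f * frob p g) $$ n = (\<Sum>j\<in>J. f $$ (n - int p * j) * pm_frob (int p) (g $$ j))"
proof -
  have "inj_on ((*) (int p)) J" using p by (auto simp: inj_on_def)
  moreover have "(f * frob p g) $$ n = (\<Sum>j\<in>(*) (int p) ` J. f $$ (n - j) * frob p g $$ j)"
  proof (rule fls_times_nth_superset)
    fix j assume j: "f $$ (n - j) \<noteq> 0" "frob p g $$ j \<noteq> 0"
    then obtain i where i: "j = int p * i" using frob_nth_eq_0 by (metis dvdE)
    with j have "g $$ i \<noteq> 0" using p by auto
    with i j assms(2) show "j \<in> (*) (int p) ` J" by blast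
  qed (use assms in simp)
  ultimately show ?thesis by (simp add: sum.reindex)
qed

text \<open>The projection formula again, now in the degree of \<open>t\<close> as well.\<close>

lemma cartier_times_frob: "cartier p (f * frob p g) = cartier p f * g"
proof (rule fls_eqI)
  fix n
  \<comment> \<open>One index set for both convolutions, the one at \<open>p * n\<close> with step
    \<open>p\<close> and the one at \<open>n\<close>.\<close>
  define J where "J = {fls_subdegree g..n + \<bar>fls_subdegree f\<bar>}"
  have J: "j \<in> J" if "f $$ (int p * n - int p * j) \<noteq> 0" "g $$ j \<noteq> 0" for j
  proof -
    have "int p * n - int p * j \<ge> fls_subdegree f" "j \<ge> fls_subdegree g"
      using that fls_eq0_below_subdegree not_le by blast+
    then have "int p * (n - j) \<ge> fls_subdegree f" by (simp add: right_diff_distrib)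
    then have "n - j \<ge> - \<bar>fls_subdegree f\<bar>"
    proof (cases "n - j \<ge> 0")
      case False
      then have "int p * (n - j) \<le> 1 * (n - j)" using p by (intro mult_right_mono_neg) auto
      with \<open>int p * (n - j) \<ge> _\<close> have "fls_subdegree f \<le> 1 * (n - j)" by (rule order_trans)
      then show ?thesis by simp
    qed simp
    then show ?thesis using \<open>j \<ge> _\<close> by (simp add: J_def)
  qed
  have "cartier p (f * frob p g) $$ n =
      (\<Sum>j\<in>J. pm_cartier (int p) (f $$ (int p * n - int p * j) * pm_frob (int p) (g $$ j)))"
    using J p by (simp add: times_frob_nth[of J] J_def pm_cartier_sum)
  also have "\<dots> = (\<Sum>j\<in>J. cartier p f $$ (n - j) * g $$ j)"
    using p by (simp add: pm_cartier_times_frob right_diff_distrib)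
  also have "\<dots> = (cartier p f * g) $$ n"
  proof (rule fls_times_nth_superset[symmetric])
    fix j assume "cartier p f $$ (n - j) \<noteq> 0" "g $$ j \<noteq> 0"
    then show "j \<in> J" using p by (intro J) (auto simp: right_diff_distrib)
  qed (simp add: J_def)
  finally show "cartier p (f * frob p g) $$ n = (cartier p f * g) $$ n" .
qed

lemma frob_mult: "frob p (f * g) = frob p f * frob p g"
proof (rule frob_eqI)
  fix n
  define J where "J = {fls_subdegree g..n - fls_subdegree f}"
  have J: "j \<in> J" if "f $$ (n - j) \<noteq> 0" "g $$ j \<noteq> 0" for j
  proof -
    have "n - j \<ge> fls_subdegree f" "j \<ge> fls_subdegree g"
      using that fls_eq0_below_subdegree not_le by blast+
    then show ?thesis by (simp add: J_def)
  qed
  have "(frob p f * frob p g) $$ (int p * n) =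
      (\<Sum>j\<in>J. frob p f $$ (int p * (n - j)) * pm_frob (int p) (g $$ j))"
    unfolding right_diff_distrib
  proof (rule times_frob_nth)
    fix j assume "frob p f $$ (int p * n - int p * j) \<noteq> 0" "g $$ j \<noteq> 0"
    then show "j \<in> J" using p by (intro J) (auto simp flip: right_diff_distrib)
  qed (simp add: J_def)
  also have "\<dots> = pm_frob (int p) (\<Sum>j\<in>J. f $$ (n - j) * g $$ j)"
    using p by (simp add: pm_frob_sum pm_frob_mult)
  also have "(\<Sum>j\<in>J. f $$ (n - j) * g $$ j) = (f * g) $$ n"
    using J by (intro fls_times_nth_superset[symmetric]) (auto simp: J_def)
  finally show "(frob p f * frob p g) $$ (int p * n) = pm_frob (int p) ((f * g) $$ n)" .
next
  fix n assume n: "\<not> int p dvd n"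
  define J where "J = {j. frob p f $$ (n - int p * j) \<noteq> 0 \<and> g $$ j \<noteq> 0}"
  \<comment> \<open>A nonzero coefficient at \<open>n - p * j\<close> would force \<open>p\<close>
    to divide \<open>n\<close>.\<close>
  have "J = {}"
    using n by (auto simp: J_def frob_nth_full dest: zdvd_zdiffD split: if_splits)
  then show "(frob p f * frob p g) $$ n = 0"
    by (subst times_frob_nth[of "{}"]) (auto simp: J_def)
qed

lemma frob_power: "frob p (f ^ n) = frob p f ^ n"
  by (induction n) (simp_all add: frob_mult)

end

section \<open>Congruences between Laurent series\<close>

definition ser_coeff :: "'v::finite lseries \<Rightarrow> int \<Rightarrow> int ^ 'v \<Rightarrow> rat" where
  "ser_coeff f n l = Poly_Mapping.lookup (f $$ n) l"

lemma ser_coeff_0 [simp]: "ser_coeff 0 n l = 0"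
  and ser_coeff_add: "ser_coeff (f + g) n l = ser_coeff f n l + ser_coeff g n l"
  and ser_coeff_diff: "ser_coeff (f - g) n l = ser_coeff f n l - ser_coeff g n l"
  and ser_coeff_uminus: "ser_coeff (- f) n l = - ser_coeff f n l"
  by (simp_all add: ser_coeff_def lookup_add lookup_minus)

lemma ser_coeff_sum: "ser_coeff (sum f A) n l = (\<Sum>i\<in>A. ser_coeff (f i) n l)"
  by (induction A rule: infinite_finite_induct) (simp_all add: ser_coeff_add)

lemma ser_coeff_of_nat: "ser_coeff (of_nat m) n l = (if n = 0 \<and> l = 0 then of_nat m else 0)"
  by (simp add: ser_coeff_def fls_of_nat lookup_single when_def flip: single_of_nat)

lemma ser_coeff_1: "ser_coeff 1 n l = (if n = 0 \<and> l = 0 then 1 else 0)"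
  by (metis ser_coeff_of_nat of_nat_1)

text \<open>The index sets stay abstract because integrality and support arguments only use that
  each coefficient of a product is a finite sum of products.\<close>

lemma ser_coeff_mult:
  "\<exists>J K. finite J \<and> (\<forall>j. finite (K j)) \<and>
    ser_coeff (f * g) n l = (\<Sum>j\<in>J. \<Sum>k\<in>K j. ser_coeff f (n - j) (l - k) * ser_coeff g j k)"
proof (intro exI conjI allI)
  show "ser_coeff (f * g) n l = (\<Sum>j=fls_subdegree g..n - fls_subdegree f.
      \<Sum>k\<in>Poly_Mapping.keys (g $$ j). ser_coeff f (n - j) (l - k) * ser_coeff g j k)"
    unfolding ser_coeff_def
  proof (subst fls_times_nth_superset)
    fix j assume "f $$ (n - j) \<noteq> 0" "g $$ j \<noteq> 0"
    then have "n - j \<ge> fls_subdegree f" "j \<ge> fls_subdegree g"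
      using fls_eq0_below_subdegree not_le by blast+
    then show "j \<in> {fls_subdegree g..n - fls_subdegree f}" by simp
  qed (simp_all add: lookup_sum lookup_times[OF finite_keys order_refl])
qed simp_all

lemma ser_coeff_mult_nonzeroE:
  assumes "ser_coeff (f * g) n l \<noteq> 0"
  obtains j k where "ser_coeff f (n - j) (l - k) \<noteq> 0" "ser_coeff g j k \<noteq> 0"
proof -
  obtain J K where "ser_coeff (f * g) n l = (\<Sum>j\<in>J. \<Sum>k\<in>K j. ser_coeff f (n - j) (l - k) * ser_coeff g j k)"
    using ser_coeff_mult by blast
  with assms obtain j where "(\<Sum>k\<in>K j. ser_coeff f (n - j) (l - k) * ser_coeff g j k) \<noteq> 0"
    by (metis (no_types, lifting) sum.neutral)
  then obtain k where "ser_coeff f (n - j) (l - k) * ser_coeff g j k \<noteq> 0"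
    by (metis (no_types, lifting) sum.neutral)
  then show thesis using that mult_not_zero by blast
qed

text \<open>Divisibility by \<open>p ^ r\<close> among series with \<open>p\<close>-integral
  coefficients; \<open>r = 0\<close> expresses integrality itself.\<close>

definition pdiv :: "nat \<Rightarrow> nat \<Rightarrow> 'v::finite lseries \<Rightarrow> bool" where
  "pdiv p r f \<longleftrightarrow> (\<forall>n l. p_integral p (ser_coeff f n l / of_nat (p ^ r)))"

text \<open>The Frobenius congruence modulo \<open>p\<close>. It is obtained below from monomials by
  closure under sums, products, negation and integral inverses.\<close>

definition frob_lift :: "nat \<Rightarrow> 'v::finite lseries \<Rightarrow> bool" where
  "frob_lift p w \<longleftrightarrow> pdiv p 0 w \<and> pdiv p 1 (w ^ p - frob p w)"

text \<open>Divisibility that grows with the power of \<open>p\<close> dividing the degree. For a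
  Gauss series \<open>G\<close>, the difference \<open>cartier p G - G\<close> has it with
  \<open>s = 1\<close>.\<close>

definition pdiv_along_rays :: "nat \<Rightarrow> nat \<Rightarrow> 'v::finite lseries \<Rightarrow> bool" where
  "pdiv_along_rays p s f \<longleftrightarrow>
    (\<forall>e n l. p_integral p (ser_coeff f (int (p ^ e) * n) (int (p ^ e) *s l) / of_nat (p ^ (e + s))))"

text \<open>The Gauss congruences in the joint degree \<open>(n, l)\<close>; \<open>Suc r\<close>
  stands for the exponent \<open>r \<ge> 1\<close> of \<open>gauss_congruences\<close>.\<close>

definition gauss_series :: "nat \<Rightarrow> 'v::finite lseries \<Rightarrow> bool" where
  "gauss_series p f \<longleftrightarrow> pdiv p 0 f \<and>
    (\<forall>r n l. p_integral p ((ser_coeff f (int (p ^ Suc r) * n) (int (p ^ Suc r) *s l)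
      - ser_coeff f (int (p ^ r) * n) (int (p ^ r) *s l)) / of_nat (p ^ Suc r)))"

context
  fixes p :: nat
  assumes p: "prime p"
begin

private lemma p_pos: "p > 0" using p prime_gt_0_nat by blast

lemma pdiv_0 [simp]: "pdiv p r 0"
  using p by (simp add: pdiv_def)

lemma pdiv_add: "pdiv p r f \<Longrightarrow> pdiv p r g \<Longrightarrow> pdiv p r (f + g)"
  using p_integral_add[OF p] by (simp add: pdiv_def ser_coeff_add add_divide_distrib)

lemma pdiv_uminus: "pdiv p r f \<Longrightarrow> pdiv p r (- f)"
  using p_integral_uminus[OF p] by (auto simp: pdiv_def ser_coeff_uminus)

lemma pdiv_sum: "(\<And>i. i \<in> A \<Longrightarrow> pdiv p r (f i)) \<Longrightarrow> pdiv p r (sum f A)"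
  by (induction A rule: infinite_finite_induct) (auto intro: pdiv_add)

lemma pdiv_mono: "pdiv p s f \<Longrightarrow> r \<le> s \<Longrightarrow> pdiv p r f"
  unfolding pdiv_def using p_integral_power_divide_mono[OF p] by blast

lemma pdiv_mult:
  assumes "pdiv p r f" "pdiv p s g"
  shows "pdiv p (r + s) (f * g)"
  unfolding pdiv_def
proof (intro allI)
  fix n l
  obtain J K where JK: "ser_coeff (f * g) n l =
      (\<Sum>j\<in>J. \<Sum>k\<in>K j. ser_coeff f (n - j) (l - k) * ser_coeff g j k)"
    using ser_coeff_mult by blast
  have "p_integral p (\<Sum>j\<in>J. \<Sum>k\<in>K j.
      ser_coeff f (n - j) (l - k) / of_nat (p ^ r) * (ser_coeff g j k / of_nat (p ^ s)))"
    using assms by (intro p_integral_sum p_integral_mult p) (auto simp: pdiv_def)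
  also have "(\<Sum>j\<in>J. \<Sum>k\<in>K j.
      ser_coeff f (n - j) (l - k) / of_nat (p ^ r) * (ser_coeff g j k / of_nat (p ^ s)))
      = ser_coeff (f * g) n l / of_nat (p ^ (r + s))"
    by (simp add: JK power_add sum_divide_distrib)
  finally show "p_integral p (ser_coeff (f * g) n l / of_nat (p ^ (r + s)))" .
qed

lemma pdiv_of_nat:
  assumes "p ^ r dvd m"
  shows "pdiv p r (of_nat m)"
proof -
  obtain k where "m = p ^ r * k" using assms by blast
  then have "rat_of_nat m / of_nat (p ^ r) = of_nat k" using p_pos by simp
  then show ?thesis using p by (simp add: pdiv_def ser_coeff_of_nat del: of_nat_power)
qed

lemma pdiv_1 [simp]: "pdiv p 0 1"
  using pdiv_of_nat[of 0 1] by simp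

lemma pdiv_power: "pdiv p r f \<Longrightarrow> pdiv p (r * k) (f ^ k)"
  using pdiv_mult by (induction k) (auto)

lemma pdiv_power_0: "pdiv p 0 f \<Longrightarrow> pdiv p 0 (f ^ k)"
  using pdiv_power[of 0] by simp

text \<open>Each mixed term has a binomial coefficient divisible by \<open>p\<close> and at least
  one factor \<open>f\<close>, which contributes \<open>p ^ r\<close>.\<close>

lemma pdiv_binomial:
  assumes "pdiv p r f" "pdiv p 0 g"
  shows "pdiv p (r + 1) ((f + g) ^ p - f ^ p - g ^ p)"
proof -
  have "{..p} = insert 0 (insert p {0<..<p})" using p_pos by auto
  then have "(f + g) ^ p - f ^ p - g ^ p =
      (\<Sum>k\<in>{0<..<p}. of_nat (p choose k) * f ^ k * g ^ (p - k))"
    using p_pos by (simp add: binomial_ring)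
  also have "pdiv p (r + 1) \<dots>"
  proof (rule pdiv_sum)
    fix k assume k: "k \<in> {0<..<p}"
    then have "p dvd p choose k" using p by (intro dvd_choose_prime) auto
    then have "pdiv p 1 (of_nat (p choose k))" by (intro pdiv_of_nat) simp
    moreover have "pdiv p r (f ^ k)"
      using k by (intro pdiv_mono[OF pdiv_power[OF assms(1)]]) auto
    ultimately have "pdiv p (1 + r + 0) (of_nat (p choose k) * f ^ k * g ^ (p - k))"
      using assms(2) by (intro pdiv_mult pdiv_power_0)
    then show "pdiv p (r + 1) (of_nat (p choose k) * f ^ k * g ^ (p - k))" by simp
  qed
  finally show ?thesis .
qed

text \<open>Expand \<open>u = (u - v) + v\<close>. The mixed terms gain a factor \<open>p\<close>,
  and \<open>(u - v) ^ p\<close> is divisible by \<open>p ^ (r * p)\<close>, where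
  \<open>r * p \<ge> r + 1\<close> because \<open>r \<ge> 1\<close>.\<close>

lemma pdiv_power_p_diff:
  assumes "pdiv p r (u - v)" "r \<ge> 1" "pdiv p 0 v"
  shows "pdiv p (r + 1) (u ^ p - v ^ p)"
proof -
  have "r + 1 \<le> r * 2" "r * 2 \<le> r * p" using assms(2) prime_ge_2_nat[OF p] by auto
  then have "r + 1 \<le> r * p" by linarith
  then have "pdiv p (r + 1) ((u - v) ^ p)"
    using pdiv_mono[OF pdiv_power[OF assms(1)]] by blast
  then show ?thesis
    using pdiv_add[OF pdiv_binomial[OF assms(1,3)]] by fastforce
qed

lemma pdiv_frob:
  assumes "pdiv p r f"
  shows "pdiv p r (frob p f)"
  unfolding pdiv_def
proof (intro allI)
  fix n l
  show "p_integral p (ser_coeff (frob p f) n l / of_nat (p ^ r))"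
  proof (cases "int p dvd n \<and> (\<exists>k. l = int p *s k)")
    case True
    then obtain m k where "n = int p * m" "l = int p *s k" by blast
    then have "ser_coeff (frob p f) n l = ser_coeff f m k" using p_pos by (simp add: ser_coeff_def)
    then show ?thesis using assms by (simp add: pdiv_def)
  next
    case False
    then have "ser_coeff (frob p f) n l = 0"
      using p_pos by (auto simp: ser_coeff_def frob_nth_full lookup_pm_frob_eq_0)
    then show ?thesis using p by simp
  qed
qed

lemma frob_lift_pdiv: "frob_lift p f \<Longrightarrow> pdiv p 0 f"
  by (simp add: frob_lift_def)

lemma frob_lift_1 [simp]: "frob_lift p 1"
  using p_pos by (simp add: frob_lift_def)

lemma frob_lift_add:
  assumes "frob_lift p f" "frob_lift p g"
  shows "frob_lift p (f + g)"
proof -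
  have "(f + g) ^ p - frob p (f + g) =
      (f ^ p - frob p f) + (g ^ p - frob p g) + ((f + g) ^ p - f ^ p - g ^ p)"
    by (simp add: frob_add[OF p_pos] algebra_simps)
  moreover have "pdiv p 1 ((f + g) ^ p - f ^ p - g ^ p)"
    using pdiv_binomial[of 0 f g] assms by (simp add: frob_lift_def)
  ultimately have "pdiv p 1 ((f + g) ^ p - frob p (f + g))"
    using assms unfolding frob_lift_def by (metis pdiv_add)
  then show ?thesis using assms pdiv_add unfolding frob_lift_def by blast
qed

lemma frob_lift_mult:
  assumes "frob_lift p f" "frob_lift p g"
  shows "frob_lift p (f * g)"
proof -
  have "(f * g) ^ p - frob p (f * g) = f ^ p * (g ^ p - frob p g) + (f ^ p - frob p f) * frob p g"
    by (simp add: frob_mult[OF p_pos] power_mult_distrib algebra_simps)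
  moreover have "pdiv p (0 + 1) (f ^ p * (g ^ p - frob p g))"
    using assms by (intro pdiv_mult pdiv_power_0) (auto simp: frob_lift_def)
  moreover have "pdiv p (1 + 0) ((f ^ p - frob p f) * frob p g)"
    using assms by (intro pdiv_mult pdiv_frob) (auto simp: frob_lift_def)
  moreover have "pdiv p (0 + 0) (f * g)"
    using assms by (intro pdiv_mult) (auto simp: frob_lift_def)
  ultimately show ?thesis by (auto simp: frob_lift_def intro: pdiv_add)
qed

text \<open>Inverses of congruent elements are congruent. Integrality of \<open>g\<close> is a
  genuine condition: \<open>f\<close> could be the constant \<open>p\<close>.\<close>

lemma frob_lift_inverse:
  assumes "frob_lift p f" "f * g = 1" "pdiv p 0 g"
  shows "frob_lift p g"
proof -
  have f: "f ^ p * g ^ p = 1" "frob p f * frob p g = 1"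
    using assms(2) by (simp_all add: frob_1[OF p_pos] flip: power_mult_distrib frob_mult[OF p_pos])
  have "g ^ p - frob p g = g ^ p * (frob p f * frob p g) - (f ^ p * g ^ p) * frob p g"
    by (simp add: f)
  also have "\<dots> = - (g ^ p * frob p g * (f ^ p - frob p f))"
    by (simp add: algebra_simps)
  finally have eq: "g ^ p - frob p g = - (g ^ p * frob p g * (f ^ p - frob p f))" .
  have "pdiv p (0 + 0 + 1) (g ^ p * frob p g * (f ^ p - frob p f))"
    using assms by (intro pdiv_mult pdiv_power_0 pdiv_frob) (auto simp: frob_lift_def)
  then show ?thesis using assms(3) pdiv_uminus by (auto simp: frob_lift_def eq)
qed

lemma frob_0: "frob p 0 = (0 :: 'a::finite lseries)"
  using frob_add[OF p_pos, of 0 "0 :: 'a lseries"] by simp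

lemma frob_lift_minus_1: "frob_lift p (- 1 :: 'a::finite lseries)"
proof -
  have "frob p (- 1) + frob p 1 = (0 :: 'a lseries)"
    by (simp add: frob_0 flip: frob_add[OF p_pos])
  then have "frob p (- 1) = (- 1 :: 'a lseries)"
    by (simp add: frob_1[OF p_pos] eq_neg_iff_add_eq_0)
  moreover have "pdiv p 1 ((- 1) ^ p + 1 :: 'a lseries)"
  \<comment> \<open>For \<open>p = 2\<close> the difference is 2, not 0, but still divisible by
    \<open>p\<close>.\<close>
  proof (cases "p = 2")
    case True
    then show ?thesis using pdiv_of_nat[of 1 2] by simp
  next
    case False
    then have "odd p" using p primes_dvd_imp_eq two_is_prime_nat by blast
    then show ?thesis by simp
  qed
  ultimately show ?thesis by (simp add: frob_lift_def pdiv_uminus)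
qed

lemma frob_lift_uminus: "frob_lift p f \<Longrightarrow> frob_lift p (- f)"
  using frob_lift_mult[OF frob_lift_minus_1, of f] by simp

lemma frob_lift_power: "frob_lift p f \<Longrightarrow> frob_lift p (f ^ k)"
  by (induction k) (auto intro: frob_lift_mult)

lemma frob_lift_0: "frob_lift p 0"
  using p_pos by (simp add: frob_lift_def frob_0 power_0_left)

lemma frob_lift_sum: "(\<And>i. i \<in> A \<Longrightarrow> frob_lift p (f i)) \<Longrightarrow> frob_lift p (sum f A)"
  by (induction A rule: infinite_finite_induct) (auto intro: frob_lift_add simp: frob_lift_0)

lemma frob_lift_of_nat_mult: "frob_lift p f \<Longrightarrow> frob_lift p (of_nat m * f)"
  by (induction m) (auto simp: frob_lift_0 distrib_right intro: frob_lift_add)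

lemma frob_lift_of_int_mult: "frob_lift p f \<Longrightarrow> frob_lift p (of_int m * f)"
  by (cases m rule: int_cases2) (auto intro: frob_lift_of_nat_mult frob_lift_uminus)

text \<open>The case \<open>r = 0\<close> is the Frobenius congruence; every further
  \<open>p\<close>-th power, which commutes with \<open>frob\<close>, raises the modulus by one
  factor \<open>p\<close>.\<close>

lemma pdiv_power_diff_frob:
  assumes "frob_lift p w"
  shows "pdiv p (Suc r) (w ^ (p ^ Suc r) - frob p (w ^ (p ^ r)))"
proof (induction r)
  case 0
  then show ?case using assms by (simp add: frob_lift_def)
next
  case (Suc r)
  have "pdiv p (Suc r + 1) ((w ^ (p ^ Suc r)) ^ p - (frob p (w ^ (p ^ r))) ^ p)"
    using assms by (intro pdiv_power_p_diff Suc.IH pdiv_frob pdiv_power_0 frob_lift_pdiv) auto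
  then show ?case by (simp add: mult.commute flip: power_mult frob_power[OF p_pos])
qed

lemma ser_coeff_cartier: "ser_coeff (cartier p f) n l = ser_coeff f (int p * n) (int p *s l)"
  using p_pos by (simp add: ser_coeff_def)

lemma ser_coeff_times_frob:
  "ser_coeff (f * frob p g) (int p * n) (int p *s l) = ser_coeff (cartier p f * g) n l"
  by (simp flip: ser_coeff_cartier cartier_times_frob[OF p_pos])

text \<open>Induction on \<open>e\<close>: replace \<open>w ^ (p ^ Suc e)\<close> by
  \<open>frob p (w ^ (p ^ e))\<close>. The projection formula then removes one factor
  \<open>p\<close> from the degree and turns \<open>H\<close> into \<open>cartier p H\<close>, which
  satisfies the hypothesis for \<open>Suc s\<close>.\<close>

lemma pdiv_along_rays_times_power:
  assumes "frob_lift p w" "pdiv_along_rays p s H"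
  shows "p_integral p (ser_coeff (H * w ^ (p ^ e)) (int (p ^ e) * n) (int (p ^ e) *s l) / of_nat (p ^ (e + s)))"
  using assms(2)
proof (induction e arbitrary: H s n l)
  case 0
  have "pdiv p s H" using 0[unfolded pdiv_along_rays_def, rule_format, of 0] by (simp add: pdiv_def)
  then have "pdiv p (s + 0) (H * w)" using assms(1) by (intro pdiv_mult frob_lift_pdiv)
  then show ?case by (simp add: pdiv_def)
next
  case (Suc e)
  define E where "E = w ^ (p ^ Suc e) - frob p (w ^ (p ^ e))"
  have "pdiv p s H" using Suc.prems[unfolded pdiv_along_rays_def, rule_format, of 0] by (simp add: pdiv_def)
  \<comment> \<open>The replacement error is harmless: \<open>p ^ s\<close> comes from
    \<open>H\<close> and \<open>p ^ Suc e\<close> from \<open>E\<close>.\<close>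
  then have "pdiv p (s + Suc e) (H * E)"
    unfolding E_def by (intro pdiv_mult pdiv_power_diff_frob assms(1))
  then have HE: "p_integral p (ser_coeff (H * E) (int (p ^ Suc e) * n) (int (p ^ Suc e) *s l)
      / of_nat (p ^ (Suc e + s)))"
    by (simp add: pdiv_def add.commute)
  have "pdiv_along_rays p (Suc s) (cartier p H)"
    unfolding pdiv_along_rays_def ser_coeff_cartier
    using Suc.prems[unfolded pdiv_along_rays_def, rule_format, of "Suc _"]
    by (simp add: mult.assoc vector_smult_assoc)
  from Suc.IH[OF this, of n l]
  have "p_integral p (ser_coeff (cartier p H * w ^ (p ^ e)) (int (p ^ e) * n) (int (p ^ e) *s l)
      / of_nat (p ^ (Suc e + s)))" by simp
  also have "ser_coeff (cartier p H * w ^ (p ^ e)) (int (p ^ e) * n) (int (p ^ e) *s l) =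
      ser_coeff (H * frob p (w ^ (p ^ e))) (int (p ^ Suc e) * n) (int (p ^ Suc e) *s l)"
    by (simp add: mult.assoc vector_smult_assoc flip: ser_coeff_times_frob)
  finally have "p_integral p (ser_coeff (H * frob p (w ^ (p ^ e))) (int (p ^ Suc e) * n)
      (int (p ^ Suc e) *s l) / of_nat (p ^ (Suc e + s)))" .
  from p_integral_add[OF p this HE]
  show ?case
    by (simp only: flip: add_divide_distrib ser_coeff_add distrib_left) (simp add: E_def)
qed

text \<open>After \<open>w ^ (p ^ Suc r)\<close> is replaced by \<open>frob p (w ^ (p ^ r))\<close>,
  the projection formula rewrites the difference as a coefficient of
  \<open>(cartier p G - G) * w ^ (p ^ r)\<close>, to which the preceding lemma applies with
  \<open>s = 1\<close>.\<close>

lemma gauss_times_power: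
  assumes "frob_lift p w" "gauss_series p G"
  shows "p_integral p ((ser_coeff (G * w ^ (p ^ Suc r)) (int (p ^ Suc r) * n) (int (p ^ Suc r) *s l)
      - ser_coeff (G * w ^ (p ^ r)) (int (p ^ r) * n) (int (p ^ r) *s l)) / of_nat (p ^ Suc r))"
proof -
  define E where "E = w ^ (p ^ Suc r) - frob p (w ^ (p ^ r))"
  have "pdiv p (0 + Suc r) (G * E)"
    unfolding E_def using assms(2) by (intro pdiv_mult pdiv_power_diff_frob assms(1)) (simp add: gauss_series_def)
  then have GE: "p_integral p (ser_coeff (G * E) (int (p ^ Suc r) * n) (int (p ^ Suc r) *s l) / of_nat (p ^ Suc r))"
    by (simp add: pdiv_def)
  have "pdiv_along_rays p 1 (cartier p G - G)"
    using assms(2) unfolding pdiv_along_rays_def gauss_series_def ser_coeff_cartier ser_coeff_diff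
    by (simp add: mult.assoc vector_smult_assoc)
  from pdiv_along_rays_times_power[OF assms(1) this, of r n l]
  have "p_integral p ((ser_coeff (cartier p G * w ^ (p ^ r)) (int (p ^ r) * n) (int (p ^ r) *s l)
      - ser_coeff (G * w ^ (p ^ r)) (int (p ^ r) * n) (int (p ^ r) *s l)) / of_nat (p ^ Suc r))"
    by (simp add: left_diff_distrib ser_coeff_diff)
  also have "ser_coeff (cartier p G * w ^ (p ^ r)) (int (p ^ r) * n) (int (p ^ r) *s l) =
      ser_coeff (G * frob p (w ^ (p ^ r))) (int (p ^ Suc r) * n) (int (p ^ Suc r) *s l)"
    by (simp add: mult.assoc vector_smult_assoc flip: ser_coeff_times_frob)
  finally have "p_integral p ((ser_coeff (G * frob p (w ^ (p ^ r))) (int (p ^ Suc r) * n) (int (p ^ Suc r) *s l)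
      - ser_coeff (G * w ^ (p ^ r)) (int (p ^ r) * n) (int (p ^ r) *s l)) / of_nat (p ^ Suc r))" .
  from p_integral_add[OF p this GE]
  show ?thesis
    by (simp add: E_def right_diff_distrib ser_coeff_diff diff_divide_distrib)
qed

lemma gauss_add:
  assumes "gauss_series p f" "gauss_series p g"
  shows "gauss_series p (f + g)"
  unfolding gauss_series_def
proof (intro conjI allI)
  fix r n l
  have "p_integral p ((ser_coeff f (int (p ^ Suc r) * n) (int (p ^ Suc r) *s l)
      - ser_coeff f (int (p ^ r) * n) (int (p ^ r) *s l)) / of_nat (p ^ Suc r) +
      (ser_coeff g (int (p ^ Suc r) * n) (int (p ^ Suc r) *s l)
      - ser_coeff g (int (p ^ r) * n) (int (p ^ r) *s l)) / of_nat (p ^ Suc r))"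
    using assms unfolding gauss_series_def by (intro p_integral_add p) blast+
  then show "p_integral p ((ser_coeff (f + g) (int (p ^ Suc r) * n) (int (p ^ Suc r) *s l)
      - ser_coeff (f + g) (int (p ^ r) * n) (int (p ^ r) *s l)) / of_nat (p ^ Suc r))"
    by (simp add: ser_coeff_add add_divide_distrib diff_divide_distrib algebra_simps)
qed (use assms pdiv_add in \<open>auto simp: gauss_series_def\<close>)

lemma gauss_0: "gauss_series p 0"
  using p by (simp add: gauss_series_def)

lemma gauss_sum: "(\<And>i. i \<in> A \<Longrightarrow> gauss_series p (f i)) \<Longrightarrow> gauss_series p (sum f A)"
  by (induction A rule: infinite_finite_induct) (auto intro: gauss_add simp: gauss_0)

lemma gauss_uminus:
  assumes "gauss_series p f"
  shows "gauss_series p (- f)"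
  unfolding gauss_series_def
proof (intro conjI allI)
  fix r n l
  have "p_integral p (- ((ser_coeff f (int (p ^ Suc r) * n) (int (p ^ Suc r) *s l)
      - ser_coeff f (int (p ^ r) * n) (int (p ^ r) *s l)) / of_nat (p ^ Suc r)))"
    using assms unfolding gauss_series_def by (intro p_integral_uminus p) blast+
  then show "p_integral p ((ser_coeff (- f) (int (p ^ Suc r) * n) (int (p ^ Suc r) *s l)
      - ser_coeff (- f) (int (p ^ r) * n) (int (p ^ r) *s l)) / of_nat (p ^ Suc r))"
    by (simp add: ser_coeff_uminus diff_divide_distrib)
qed (use assms pdiv_uminus in \<open>auto simp: gauss_series_def\<close>)

lemma gauss_diff: "gauss_series p f \<Longrightarrow> gauss_series p g \<Longrightarrow> gauss_series p (f - g)"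
  using gauss_add[of f "- g"] gauss_uminus[of g] by simp

end

section \<open>Geometric series\<close>

lemma ser_coeff_below_subdegree: "ser_coeff f n l \<noteq> 0 \<Longrightarrow> fls_subdegree f \<le> n"
  by (rule ccontr) (simp add: ser_coeff_def)

text \<open>Degrees add up. The exact degree in variable \<open>i\<close> separates the powers of
  \<open>W\<close>; the bound on \<open>n\<close> makes them tend to zero in
  \<open>t\<close>.\<close>

lemma ser_coeff_power_nonzero:
  assumes "\<And>n l. ser_coeff W n l \<noteq> 0 \<Longrightarrow> l $ i = \<epsilon> \<and> n \<ge> 1" "ser_coeff (W ^ j) n l \<noteq> 0"
  shows "l $ i = int j * \<epsilon> \<and> n \<ge> int j"
  using assms(2)
proof (induction j arbitrary: n l)
  case 0
  then show ?case by (simp add: ser_coeff_1 split: if_splits)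
next
  case (Suc j)
  from Suc.prems have "ser_coeff (W * W ^ j) n l \<noteq> 0" by simp
  then obtain m k where "ser_coeff W (n - m) (l - k) \<noteq> 0" "ser_coeff (W ^ j) m k \<noteq> 0"
    by (rule ser_coeff_mult_nonzeroE)
  then have "(l - k) $ i = \<epsilon> \<and> n - m \<ge> 1" "k $ i = int j * \<epsilon> \<and> m \<ge> int j"
    using assms(1) Suc.IH by blast+
  then show ?case by (auto simp: algebra_simps)
qed

text \<open>All terms of \<open>G * W ^ j\<close> have degree \<open>j * \<epsilon>\<close> in
  variable \<open>i\<close>, so a given degree meets at most one term of the geometric series for
  \<open>Y\<close>.\<close>

lemma ser_coeff_times_geometric:
  fixes G W Y :: "'v::finite lseries"
  assumes G: "\<And>n l. ser_coeff G n l \<noteq> 0 \<Longrightarrow> l $ i = 0"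
    and W: "\<And>n l. ser_coeff W n l \<noteq> 0 \<Longrightarrow> l $ i = \<epsilon> \<and> n \<ge> 1" and \<epsilon>: "\<bar>\<epsilon>\<bar> = 1"
    and Y: "Y * (1 - W) = 1"
  shows "ser_coeff (G * Y) n l = (if \<epsilon> * l $ i \<ge> 0 then ser_coeff (G * W ^ nat (\<epsilon> * l $ i)) n l else 0)"
proof -
  have degree: "l $ i = int j * \<epsilon>" if "ser_coeff (G * W ^ j) n l \<noteq> 0" for j
  proof -
    obtain m k where "ser_coeff G (n - m) (l - k) \<noteq> 0" "ser_coeff (W ^ j) m k \<noteq> 0"
      using \<open>ser_coeff (G * W ^ j) n l \<noteq> 0\<close> by (rule ser_coeff_mult_nonzeroE)
    then have "(l - k) $ i = 0" "k $ i = int j * \<epsilon>"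
      using G ser_coeff_power_nonzero[of W, OF W] by blast+
    then show ?thesis by simp
  qed
  \<comment> \<open>The truncation point lies beyond the one relevant power and is so large that the
    remainder \<open>G * Y * W ^ M\<close> starts above degree \<open>n\<close> in
    \<open>t\<close>.\<close>
  define M where "M = Suc (nat (\<epsilon> * l $ i) + nat (n - fls_subdegree (G * Y)))"
  have "(1 - W) * (\<Sum>j<M. W ^ j) = 1 - W ^ M" by (simp add: one_diff_power_eq)
  then have "Y * (1 - W ^ M) = (Y * (1 - W)) * (\<Sum>j<M. W ^ j)" by (simp only: mult.assoc)
  then have "Y * (1 - W ^ M) = (\<Sum>j<M. W ^ j)" by (simp only: Y mult_1)
  then have "Y = (\<Sum>j<M. W ^ j) + Y * W ^ M" by (simp add: right_diff_distrib diff_eq_eq)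
  then have "G * Y = G * ((\<Sum>j<M. W ^ j) + Y * W ^ M)" by simp
  also have "\<dots> = (\<Sum>j<M. G * W ^ j) + G * Y * W ^ M"
    by (simp add: distrib_left sum_distrib_left mult.assoc)
  finally have "ser_coeff (G * Y) n l = (\<Sum>j<M. ser_coeff (G * W ^ j) n l) + ser_coeff (G * Y * W ^ M) n l"
    by (metis ser_coeff_add ser_coeff_sum)
  moreover have "ser_coeff (G * Y * W ^ M) n l = 0"
  proof (rule ccontr)
    assume "ser_coeff (G * Y * W ^ M) n l \<noteq> 0"
    then obtain m k where "ser_coeff (G * Y) (n - m) (l - k) \<noteq> 0" "ser_coeff (W ^ M) m k \<noteq> 0"
      by (rule ser_coeff_mult_nonzeroE)
    then have "fls_subdegree (G * Y) \<le> n - m" "int M \<le> m"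
      using ser_coeff_below_subdegree ser_coeff_power_nonzero[of W, OF W] by blast+
    then show False by (simp add: M_def split: if_splits)
  qed
  moreover have "(\<Sum>j<M. ser_coeff (G * W ^ j) n l) =
      (\<Sum>j<M. if j = nat (\<epsilon> * l $ i) \<and> \<epsilon> * l $ i \<ge> 0 then ser_coeff (G * W ^ j) n l else 0)"
  proof (rule sum.cong[OF refl])
    fix j
    have "int j = \<epsilon> * l $ i" if "l $ i = int j * \<epsilon>"
      using \<epsilon> that by (auto simp: abs_if split: if_splits)
    then have "j = nat (\<epsilon> * l $ i) \<and> \<epsilon> * l $ i \<ge> 0" if "ser_coeff (G * W ^ j) n l \<noteq> 0"
      using degree[OF that] by (metis nat_int of_nat_0_le_iff)
    then show "ser_coeff (G * W ^ j) n l =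
        (if j = nat (\<epsilon> * l $ i) \<and> \<epsilon> * l $ i \<ge> 0 then ser_coeff (G * W ^ j) n l else 0)" by auto
  qed
  moreover have "nat (\<epsilon> * l $ i) < M" by (simp add: M_def)
  ultimately show ?thesis by (cases "\<epsilon> * l $ i \<ge> 0") (simp_all add: sum.delta)
qed

text \<open>Scaling the degree by \<open>p ^ s\<close> scales the relevant power of \<open>W\<close>
  likewise, so \<open>gauss_times_power\<close> applies to a fixed power \<open>w\<close> of
  \<open>W\<close>. If \<open>\<epsilon> * l $ i\<close> is negative, all coefficients involved
  vanish.\<close>

lemma gauss_times_geometric:
  fixes G W Y :: "'v::finite lseries"
  assumes p: "prime p" and "gauss_series p G" "frob_lift p W"
    and G: "\<And>n l. ser_coeff G n l \<noteq> 0 \<Longrightarrow> l $ i = 0"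
    and W: "\<And>n l. ser_coeff W n l \<noteq> 0 \<Longrightarrow> l $ i = \<epsilon> \<and> n \<ge> 1" and \<epsilon>: "\<bar>\<epsilon>\<bar> = 1"
    and Y: "Y * (1 - W) = 1"
  shows "gauss_series p (G * Y)"
  unfolding gauss_series_def
proof (intro conjI allI)
  have formula: "ser_coeff (G * Y) n l =
      (if \<epsilon> * l $ i \<ge> 0 then ser_coeff (G * W ^ nat (\<epsilon> * l $ i)) n l else 0)" for n l
    by (rule ser_coeff_times_geometric[OF _ _ \<epsilon> Y]) (fact G, fact W)
  have p0: "p > 0" using p prime_gt_0_nat by blast
  have "pdiv p (0 + 0) (G * W ^ j)" for j
    using assms(2,3) by (intro pdiv_mult[OF p] pdiv_power_0[OF p]) (simp_all add: gauss_series_def frob_lift_def)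
  then show "pdiv p 0 (G * Y)" using p by (simp add: pdiv_def formula)
  fix r n l
  show "p_integral p ((ser_coeff (G * Y) (int (p ^ Suc r) * n) (int (p ^ Suc r) *s l)
      - ser_coeff (G * Y) (int (p ^ r) * n) (int (p ^ r) *s l)) / of_nat (p ^ Suc r))"
  proof (cases "\<epsilon> * l $ i \<ge> 0")
    case True
    define w where "w = W ^ nat (\<epsilon> * l $ i)"
    have "ser_coeff (G * Y) (int (p ^ s) * n) (int (p ^ s) *s l) =
        ser_coeff (G * w ^ (p ^ s)) (int (p ^ s) * n) (int (p ^ s) *s l)" for s
    proof -
      have "\<epsilon> * (int (p ^ s) *s l) $ i = int (p ^ s) * (\<epsilon> * l $ i)" by simp
      moreover from this have "\<epsilon> * (int (p ^ s) *s l) $ i \<ge> 0"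
        using True by (metis mult_nonneg_nonneg of_nat_0_le_iff)
      moreover have "nat (int (p ^ s) * (\<epsilon> * l $ i)) = nat (\<epsilon> * l $ i) * p ^ s"
        using True by (simp only: nat_mult_distrib of_nat_0_le_iff nat_int mult.commute)
      ultimately show ?thesis by (simp only: formula w_def if_True flip: power_mult)
    qed
    moreover have "frob_lift p w" unfolding w_def by (rule frob_lift_power[OF p assms(3)])
    ultimately show ?thesis using gauss_times_power[OF p _ assms(2)] by metis
  next
    case False
    have "ser_coeff (G * Y) (int (p ^ s) * n) (int (p ^ s) *s l) = 0" for s
    proof -
      have "\<epsilon> * (int (p ^ s) *s l) $ i = int (p ^ s) * (\<epsilon> * l $ i)" by simp
      also have "\<dots> < 0" using False p0 by (simp add: mult_pos_neg)
      finally show ?thesis by (simp add: formula)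
    qed
    then show ?thesis using p by (simp del: power_Suc of_nat_power)
  qed
qed

section \<open>Vertices and linear functionals\<close>

text \<open>An integer-valued pairing, because its values serve as exponents of
  \<open>t\<close>.\<close>

definition idot :: "int ^ 'v \<Rightarrow> int ^ 'v \<Rightarrow> int" where
  "idot a k = (\<Sum>i\<in>UNIV. a $ i * k $ i)"

lemma idot_0 [simp]: "idot a 0 = 0"
  and idot_add: "idot a (k + l) = idot a k + idot a l"
  and idot_diff: "idot a (k - l) = idot a k - idot a l"
  and idot_scale: "idot a (d *s k) = d * idot a k"
  and idot_add_left: "idot (a + b) k = idot a k + idot b k"
  and idot_scale_left: "idot (d *s a) k = d * idot a k"
  by (simp_all add: idot_def distrib_left distrib_right right_diff_distrib sum.distrib
      sum_subtractf sum_distrib_left ac_simps)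

lemma idot_self_pos: "k \<noteq> 0 \<Longrightarrow> idot k k > 0"
proof -
  assume "k \<noteq> 0"
  then obtain i where "k $ i \<noteq> 0" by (auto simp: vec_eq_iff)
  then show ?thesis unfolding idot_def
    by (intro sum_pos2[of _ i]) (auto simp: zero_less_mult_iff linorder_neq_iff)
qed

text \<open>Perturbation, one element of \<open>X\<close> at a time: if \<open>a\<close> vanishes on
  \<open>x\<close>, pass to \<open>M *s a + x\<close>. A large \<open>M\<close> preserves what
  \<open>a\<close> already achieves, and the pairing of \<open>x\<close> with itself is
  positive.\<close>

lemma idot_generic:
  assumes "finite X" "finite D" "\<forall>d\<in>D. idot b d > 0"
  shows "\<exists>a. (\<forall>d\<in>D. idot a d > 0) \<and> (\<forall>x\<in>X. x \<noteq> 0 \<longrightarrow> idot a x \<noteq> 0)"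
  using assms(1)
proof (induction X)
  case empty
  show ?case using assms(3) by (intro exI[of _ b]) simp
next
  case (insert x X)
  obtain a where a: "\<forall>d\<in>D. idot a d > 0" "\<forall>y\<in>X. y \<noteq> 0 \<longrightarrow> idot a y \<noteq> 0"
    using insert.IH by (elim exE conjE)
  show ?case
  proof (cases "x = 0 \<or> idot a x \<noteq> 0")
    case True
    then show ?thesis using a by (intro exI[of _ a]) auto
  next
    case False
    define M where "M = 1 + (\<Sum>y\<in>D \<union> X. \<bar>idot x y\<bar>)"
    have M: "\<bar>idot x y\<bar> < M" if "y \<in> D \<union> X" for y
    proof -
      have "\<bar>idot x y\<bar> \<le> (\<Sum>y\<in>D \<union> X. \<bar>idot x y\<bar>)"
        using that assms insert.hyps by (intro member_le_sum) auto
      then show ?thesis by (simp add: M_def)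
    qed
    have "idot (M *s a + x) d > 0" if "d \<in> D" for d
    proof -
      have "idot a d \<ge> 1" using a(1) that by (simp add: int_one_le_iff_zero_less)
      moreover have "\<bar>idot x d\<bar> < M" using M that by blast
      ultimately have "M * 1 \<le> M * idot a d" by (intro mult_left_mono) linarith+
      then show ?thesis using \<open>\<bar>idot x d\<bar> < M\<close> by (simp add: idot_add_left idot_scale_left)
    qed
    moreover have "idot (M *s a + x) y \<noteq> 0" if "y \<in> X" "y \<noteq> 0" for y
    proof -
      have "idot a y \<noteq> 0" using a(2) that by blast
      then have "\<bar>idot a y\<bar> \<ge> 1" by linarith
      moreover have "\<bar>idot x y\<bar> < M" using M that by blast
      ultimately have "\<bar>M * idot a y\<bar> \<ge> M * 1" unfolding abs_mult by (intro mult_mono) linarith+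
      then show ?thesis
        using \<open>\<bar>idot x y\<bar> < M\<close> unfolding idot_add_left idot_scale_left by linarith
    qed
    moreover have "idot (M *s a + x) x \<noteq> 0"
      using False idot_self_pos[of x] by (simp add: idot_add_left idot_scale_left)
    ultimately show ?thesis by (intro exI[of _ "M *s a + x"]) simp
  qed
qed

text \<open>An integral certificate that \<open>v\<close> is a vertex; every vertex has one by
  \<open>newton_vertex_selects\<close>. Expansions at \<open>v\<close> are then bounded below in the
  direction \<open>a\<close>.\<close>

definition selects :: "int ^ 'v \<Rightarrow> (int, 'v::finite) laurent_poly \<Rightarrow> int ^ 'v \<Rightarrow> bool" where
  "selects a Q v \<longleftrightarrow> v \<in> Poly_Mapping.keys Q \<and> (\<forall>k\<in>Poly_Mapping.keys Q - {v}. idot a (k - v) > 0)"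

lemma real_idot: "real_vec a \<bullet> real_vec k = real_of_int (idot a k)"
  by (simp add: idot_def inner_vec_def real_vec_def)

text \<open>Scale a real separating functional until its gap exceeds any possible rounding error,
  then round its coordinates down.\<close>

lemma newton_vertex_selects:
  assumes "newton_vertex v Q"
  shows "\<exists>a. selects a Q v"
proof -
  obtain a e where e: "e > 0" and a: "\<forall>k \<in> Poly_Mapping.keys Q - {v}. e \<le> a \<bullet> real_vec (k - v)"
    using newton_vertex_functional[OF assms] by blast
  \<comment> \<open>\<open>S\<close> bounds the rounding error at every exponent; scaling by
    \<open>N\<close> makes the gap \<open>N * e = S + 1\<close>, so a positive amount
    survives.\<close>
  define S where "S = (\<Sum>k\<in>Poly_Mapping.keys Q. \<Sum>i\<in>UNIV. \<bar>real_of_int ((k - v) $ i)\<bar>)"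
  define N where "N = (S + 1) / e"
  define b where "b = (\<chi> i. \<lfloor>N * a $ i\<rfloor>)"
  have "idot b (k - v) > 0" if k: "k \<in> Poly_Mapping.keys Q - {v}" for k
  proof -
    have "S \<ge> 0" by (simp add: S_def sum_nonneg)
    then have "N \<ge> 0" using e by (simp add: N_def)
    have "S + 1 = N * e" using e by (simp add: N_def)
    also have "\<dots> \<le> N * (a \<bullet> real_vec (k - v))" using a k \<open>N \<ge> 0\<close> by (intro mult_left_mono) auto
    also have "\<dots> = (\<Sum>i\<in>UNIV. (N * a $ i - b $ i) * (k - v) $ i) + idot b (k - v)"
      by (simp add: idot_def inner_vec_def real_vec_def sum_distrib_left algebra_simps
          flip: sum.distrib)
    also have "(\<Sum>i\<in>UNIV. (N * a $ i - b $ i) * (k - v) $ i) \<le> (\<Sum>i\<in>UNIV. \<bar>real_of_int ((k - v) $ i)\<bar>)"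
    proof (rule sum_mono)
      fix i
      have "\<bar>(N * a $ i - b $ i) * (k - v) $ i\<bar> \<le> 1 * \<bar>real_of_int ((k - v) $ i)\<bar>"
        unfolding abs_mult
      proof (rule mult_right_mono)
        show "\<bar>N * a $ i - b $ i\<bar> \<le> 1" unfolding b_def vec_lambda_beta by linarith
      qed simp
      then show "(N * a $ i - b $ i) * (k - v) $ i \<le> \<bar>real_of_int ((k - v) $ i)\<bar>" by linarith
    qed
    also have "\<dots> \<le> S"
      unfolding S_def using k by (intro member_le_sum) (auto intro: sum_nonneg)
    finally show ?thesis by simp
  qed
  then show ?thesis using newton_vertex_in_keys[OF assms] unfolding selects_def by blast
qed

text \<open>The other exponents lie in an open half-space that excludes \<open>v\<close>, hence so
  does their convex hull.\<close>

lemma selects_newton_vertex: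
  assumes "selects a Q v"
  shows "newton_vertex v Q"
proof -
  define T where "T = real_vec ` (Poly_Mapping.keys Q - {v})"
  have "convex hull T \<subseteq> {x. real_vec a \<bullet> x > real_vec a \<bullet> real_vec v}"
  proof (rule hull_minimal)
    show "T \<subseteq> {x. real_vec a \<bullet> x > real_vec a \<bullet> real_vec v}"
      using assms by (auto simp: T_def selects_def real_idot idot_diff)
  qed (rule convex_halfspace_gt)
  then have "real_vec v \<notin> convex hull T" by auto
  then have "real_vec v extreme_point_of (convex hull (insert (real_vec v) T))"
    by (intro extreme_point_of_convex_hull_insert) (simp add: T_def)
  moreover have "insert (real_vec v) T = real_vec ` Poly_Mapping.keys Q"
    using assms by (auto simp: T_def selects_def)
  ultimately show ?thesis by (simp add: newton_vertex_def newton_polytope_def)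
qed

lemma selects_ex:
  assumes "Q \<noteq> 0" "\<And>k l. k \<in> Poly_Mapping.keys Q \<Longrightarrow> l \<in> Poly_Mapping.keys Q \<Longrightarrow> k \<noteq> l \<Longrightarrow> idot a (k - l) \<noteq> 0"
  shows "\<exists>v. selects a Q v"
proof -
  have "Poly_Mapping.keys Q \<noteq> {}" using assms(1) by simp
  then obtain v where v: "v \<in> Poly_Mapping.keys Q" "\<And>k. k \<in> Poly_Mapping.keys Q \<Longrightarrow> idot a v \<le> idot a k"
    using arg_min_if_finite[of "Poly_Mapping.keys Q" "idot a"] by (metis finite_keys linorder_le_less_linear)
  have "idot a (k - v) > 0" if "k \<in> Poly_Mapping.keys Q - {v}" for k
    using v assms(2)[of k v] that by (fastforce simp: idot_diff)
  then show ?thesis using v(1) unfolding selects_def by blast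
qed

section \<open>Support, integrality and uniqueness of expansions\<close>

lemma expansion_base_power_support:
  assumes "0 \<in> C" "\<And>x y. x \<in> C \<Longrightarrow> y \<in> C \<Longrightarrow> x + y \<in> C"
    and "\<And>k. k \<in> Poly_Mapping.keys Q - {v} \<Longrightarrow> k - v \<in> C"
    and "j \<in> Poly_Mapping.keys (expansion_base Q v ^ m)"
  shows "j \<in> C"
  using assms(4)
proof (induction m arbitrary: j)
  case 0
  then show ?case using assms(1) by simp
next
  case (Suc m)
  then have "j \<in> Poly_Mapping.keys (expansion_base Q v * expansion_base Q v ^ m)" by simp
  then obtain b c where bc: "j = b + c" "b \<in> Poly_Mapping.keys (expansion_base Q v)"
    "c \<in> Poly_Mapping.keys (expansion_base Q v ^ m)"
    using keys_mult by blast
  then show ?case using Suc.IH keys_expansion_base[of Q v] assms(2,3) by blast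
qed

lemma inverse_expansion_nonzeroE:
  assumes "inverse_expansion Q v l \<noteq> 0"
  obtains m where "l \<in> Poly_Mapping.keys (expansion_base Q v ^ m)"
proof -
  have "\<exists>m. Poly_Mapping.lookup (expansion_base Q v ^ m) l \<noteq> 0"
  proof (rule ccontr)
    assume "\<not> ?thesis"
    then have "inverse_expansion Q v l = 0" by (simp add: inverse_expansion_def)
    with assms show False by simp
  qed
  then show thesis using that by (auto simp: in_keys_iff)
qed

text \<open>\<open>C\<close> is any submonoid containing the generators \<open>k - v\<close>. Below
  it is a half-space of a functional or a coordinate hyperplane.\<close>

lemma inverse_expansion_support:
  assumes "0 \<in> C" "\<And>x y. x \<in> C \<Longrightarrow> y \<in> C \<Longrightarrow> x + y \<in> C"
    and "\<And>k. k \<in> Poly_Mapping.keys Q - {v} \<Longrightarrow> k - v \<in> C"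
    and "inverse_expansion Q v l \<noteq> 0"
  shows "l \<in> C"
  using inverse_expansion_nonzeroE[OF assms(4)] expansion_base_power_support[OF assms(1-3)] by metis

lemma laurent_expansion_nonzeroE:
  assumes "laurent_expansion P Q v l \<noteq> 0"
  obtains k where "k \<in> Poly_Mapping.keys P" "inverse_expansion Q v (l - (k - v)) \<noteq> 0"
  using assms unfolding laurent_expansion_def
  by (metis (no_types, lifting) mult_zero_right sum.neutral)

text \<open>An integral functional that is positive on the generators is at least 1 there, so the
  \<open>m\<close>-th power of the base starts in degree \<open>m\<close> and only finitely many
  powers reach down to \<open>c\<close>.\<close>

lemma inverse_expansion_bounded:
  assumes "selects a Q v"
  shows "finite {l. inverse_expansion Q v l \<noteq> 0 \<and> idot a l \<le> c}"
proof (rule finite_subset)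
  have bound: "int m \<le> idot a j" if "j \<in> Poly_Mapping.keys (expansion_base Q v ^ m)" for m j
    using that
  proof (induction m arbitrary: j)
    case 0
    then show ?case by simp
  next
    case (Suc m)
    then have "j \<in> Poly_Mapping.keys (expansion_base Q v * expansion_base Q v ^ m)" by simp
    then obtain b c where bc: "j = b + c" "b \<in> Poly_Mapping.keys (expansion_base Q v)"
      "c \<in> Poly_Mapping.keys (expansion_base Q v ^ m)"
      using keys_mult by blast
    have "idot a b \<ge> 1"
      using bc(2) keys_expansion_base[of Q v] assms by (force simp: selects_def)
    then show ?case using Suc.IH[OF bc(3)] bc(1) by (simp add: idot_add)
  qed
  show "{l. inverse_expansion Q v l \<noteq> 0 \<and> idot a l \<le> c} \<subseteq>
      (\<Union>m\<in>{..nat c}. Poly_Mapping.keys (expansion_base Q v ^ m))"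
  proof safe
    fix l assume "inverse_expansion Q v l \<noteq> 0" and l: "idot a l \<le> c"
    then obtain m where "l \<in> Poly_Mapping.keys (expansion_base Q v ^ m)"
      by (blast elim: inverse_expansion_nonzeroE)
    moreover from this have "m \<le> nat c" using bound[of l m] l by linarith
    ultimately show "l \<in> (\<Union>m\<in>{..nat c}. Poly_Mapping.keys (expansion_base Q v ^ m))" by blast
  qed
qed simp

lemma lookup_expansion_base:
  assumes "k \<noteq> v"
  shows "Poly_Mapping.lookup (expansion_base Q v) (k - v) =
    - (rat_of_int (Poly_Mapping.lookup Q k) / rat_of_int (Poly_Mapping.lookup Q v))"
proof -
  have "Poly_Mapping.lookup (expansion_base Q v) (k - v) =
      - (\<Sum>j\<in>Poly_Mapping.keys Q - {v}. if j = k then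
        rat_of_int (Poly_Mapping.lookup Q k) / rat_of_int (Poly_Mapping.lookup Q v) else 0)"
    by (auto simp: expansion_base_def lookup_sum lookup_single when_def intro!: sum.cong)
  then show ?thesis using assms by (auto simp: sum.delta in_keys_iff)
qed

text \<open>The coefficientwise form of \<open>Q\<close> times its inverse being 1. The terms
  \<open>k \<noteq> v\<close> turn the \<open>m\<close>-th power of the base into the next one, so
  the sum over \<open>m\<close> telescopes to the zeroth power.\<close>

lemma inverse_expansion_recurrence:
  assumes "newton_vertex v Q"
  shows "(\<Sum>k\<in>Poly_Mapping.keys Q. rat_of_int (Poly_Mapping.lookup Q k) * inverse_expansion Q v (l - (k - v)))
    = (if l = 0 then 1 else 0)"
proof -
  define c where "c m l = Poly_Mapping.lookup (expansion_base Q v ^ m) l" for m l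
  define q where "q k = rat_of_int (Poly_Mapping.lookup Q k)" for k
  define K where "K = Poly_Mapping.keys Q - {v}"
  have v: "v \<in> Poly_Mapping.keys Q" using assms by (rule newton_vertex_in_keys)
  then have qv: "q v \<noteq> 0" by (simp add: q_def in_keys_iff)
  have "finite (\<Union>k\<in>Poly_Mapping.keys Q. {m. c m (l - (k - v)) \<noteq> 0})"
    using finite_expansion_terms[OF assms] by (auto simp: c_def)
  \<comment> \<open>A common cutoff for all shifts of \<open>l\<close>. The shift by
    \<open>k = v\<close> is trivial, so also \<open>c M l = 0\<close>, which closes the
    telescope.\<close>
  then obtain M where "(\<Union>k\<in>Poly_Mapping.keys Q. {m. c m (l - (k - v)) \<noteq> 0}) \<subseteq> {..<M}"
    using finite_nat_bounded by blast
  then have M: "\<And>k m. k \<in> Poly_Mapping.keys Q \<Longrightarrow> c m (l - (k - v)) \<noteq> 0 \<Longrightarrow> m < M"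
    by blast
  have inv: "q v * inverse_expansion Q v (l - (k - v)) = (\<Sum>m<M. c m (l - (k - v)))"
    if "k \<in> Poly_Mapping.keys Q" for k
  proof -
    have "Sum_any (\<lambda>m. c m (l - (k - v))) = (\<Sum>m<M. c m (l - (k - v)))"
      using M[OF that] by (intro Sum_any.expand_superset) auto
    then show ?thesis using qv by (simp add: inverse_expansion_def c_def q_def)
  qed
  have step: "q v * c (Suc m) l = - (\<Sum>k\<in>K. q k * c m (l - (k - v)))" for m
  proof -
    have "c (Suc m) l = (\<Sum>d\<in>(\<lambda>k. k - v) ` K. c m (l - d) * Poly_Mapping.lookup (expansion_base Q v) d)"
      unfolding c_def power_Suc2
      by (rule lookup_times) (use keys_expansion_base[of Q v] in \<open>auto simp: K_def\<close>)
    also have "\<dots> = (\<Sum>k\<in>K. c m (l - (k - v)) * - (q k / q v))"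
      by (subst sum.reindex) (auto simp: K_def q_def lookup_expansion_base inj_on_def intro!: sum.cong)
    finally show ?thesis using qv by (simp add: sum_distrib_left sum_negf ac_simps)
  qed
  have "c M l = 0" using M[OF v, of M] by fastforce
  have "q v * (\<Sum>k\<in>Poly_Mapping.keys Q. q k * inverse_expansion Q v (l - (k - v))) =
      (\<Sum>k\<in>Poly_Mapping.keys Q. q k * (\<Sum>m<M. c m (l - (k - v))))"
    by (simp add: sum_distrib_left mult.left_commute inv[symmetric])
  also have "\<dots> = q v * (\<Sum>m<M. c m l) + (\<Sum>k\<in>K. q k * (\<Sum>m<M. c m (l - (k - v))))"
    using v by (simp add: K_def sum.remove)
  also have "(\<Sum>k\<in>K. q k * (\<Sum>m<M. c m (l - (k - v)))) = (\<Sum>m<M. - (q v * c (Suc m) l))"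
    by (simp add: step sum_distrib_left) (rule sum.swap)
  also have "q v * (\<Sum>m<M. c m l) + (\<Sum>m<M. - (q v * c (Suc m) l)) = q v * (\<Sum>m<M. c m l - c (Suc m) l)"
    by (simp add: sum_distrib_left sum_subtractf sum_negf right_diff_distrib)
  also have "(\<Sum>m<M. c m l - c (Suc m) l) = c 0 l" using \<open>c M l = 0\<close> sum_lessThan_telescope'[of "\<lambda>m. c m l" M] by simp
  finally have "(\<Sum>k\<in>Poly_Mapping.keys Q. q k * inverse_expansion Q v (l - (k - v))) = c 0 l"
    using qv by simp
  then show ?thesis by (simp add: c_def q_def lookup_one when_def)
qed

text \<open>Only powers of the coefficient of \<open>Q\<close> at \<open>v\<close> occur as
  denominators.\<close>

lemma p_integral_inverse_expansion:
  assumes p: "prime p" and "\<not> int p dvd Poly_Mapping.lookup Q v"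
  shows "p_integral p (inverse_expansion Q v l)"
proof -
  have base: "p_integral p (Poly_Mapping.lookup (expansion_base Q v) l)" for l
    unfolding expansion_base_def lookup_uminus lookup_sum lookup_single when_def
    by (intro p_integral_uminus[OF p] p_integral_sum[OF p]) (auto intro!: p_integral_divide_of_int assms simp: p)
  have power: "p_integral p (Poly_Mapping.lookup (expansion_base Q v ^ m) l)" for m l
  proof (induction m arbitrary: l)
    case 0
    then show ?case using p by (simp add: lookup_one when_def)
  next
    case (Suc m)
    show ?case unfolding power_Suc2 lookup_times[OF finite_keys order_refl]
      by (intro p_integral_sum[OF p] p_integral_mult[OF p] Suc.IH base)
  qed
  have "p_integral p (Sum_any (\<lambda>m. Poly_Mapping.lookup (expansion_base Q v ^ m) l)
      / rat_of_int (Poly_Mapping.lookup Q v))"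
    unfolding Sum_any.expand_set
    by (intro p_integral_divide_of_int p_integral_sum power assms)
  then show ?thesis by (simp add: inverse_expansion_def)
qed

lemma inverse_expansion_nonneg:
  assumes "selects a Q v" "inverse_expansion Q v l \<noteq> 0"
  shows "idot a l \<ge> 0"
proof -
  have "l \<in> {l. idot a l \<ge> 0}"
    by (rule inverse_expansion_support[OF _ _ _ assms(2)])
      (use assms(1) in \<open>auto simp: idot_add selects_def intro: less_imp_le\<close>)
  then show ?thesis by simp
qed

lemma laurent_expansion_bounded_below:
  assumes "selects a Q v"
  shows "\<exists>c. \<forall>l. laurent_expansion P Q v l \<noteq> 0 \<longrightarrow> c \<le> idot a l"
proof (intro exI allI impI)
  fix l assume "laurent_expansion P Q v l \<noteq> 0"
  then obtain k where k: "k \<in> Poly_Mapping.keys P" "inverse_expansion Q v (l - (k - v)) \<noteq> 0"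
    by (rule laurent_expansion_nonzeroE)
  have "\<bar>idot a (k - v)\<bar> \<le> (\<Sum>k\<in>Poly_Mapping.keys P. \<bar>idot a (k - v)\<bar>)"
    using k(1) by (intro member_le_sum) auto
  moreover have "idot a l - idot a (k - v) \<ge> 0"
    using inverse_expansion_nonneg[OF assms k(2)] by (simp only: idot_diff)
  ultimately show "- (\<Sum>k\<in>Poly_Mapping.keys P. \<bar>idot a (k - v)\<bar>) \<le> idot a l" by linarith
qed

lemma laurent_expansion_times:
  assumes "selects a Q v"
  shows "(\<Sum>k\<in>Poly_Mapping.keys Q. rat_of_int (Poly_Mapping.lookup Q k) * laurent_expansion P Q v (l - k))
    = rat_of_int (Poly_Mapping.lookup P l)"
proof -
  have "(\<Sum>k\<in>Poly_Mapping.keys Q. rat_of_int (Poly_Mapping.lookup Q k) * laurent_expansion P Q v (l - k)) =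
      (\<Sum>j\<in>Poly_Mapping.keys P. rat_of_int (Poly_Mapping.lookup P j) *
        (\<Sum>k\<in>Poly_Mapping.keys Q. rat_of_int (Poly_Mapping.lookup Q k) * inverse_expansion Q v (l - j - (k - v))))"
    unfolding laurent_expansion_def sum_distrib_left
    by (subst sum.swap) (intro sum.cong refl, simp add: algebra_simps)
  also have "\<dots> = (\<Sum>j\<in>Poly_Mapping.keys P. if j = l then rat_of_int (Poly_Mapping.lookup P l) else 0)"
    by (intro sum.cong refl)
      (auto simp: inverse_expansion_recurrence[OF selects_newton_vertex[OF assms]])
  finally show ?thesis by (simp add: sum.delta in_keys_iff)
qed

text \<open>The difference of two solutions satisfies the homogeneous recurrence and is bounded
  below along \<open>a\<close>; it vanishes level by level, since \<open>a\<close> is strictly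
  minimal at \<open>v\<close>.\<close>

lemma laurent_expansion_unique:
  assumes "selects a Q v"
    and "\<And>l. (\<Sum>k\<in>Poly_Mapping.keys Q. rat_of_int (Poly_Mapping.lookup Q k) * f (l - k))
      = rat_of_int (Poly_Mapping.lookup P l)"
    and "\<And>l. f l \<noteq> 0 \<Longrightarrow> c \<le> idot a l"
  shows "f = laurent_expansion P Q v"
proof -
  define h where "h l = f l - laurent_expansion P Q v l" for l
  define q where "q k = rat_of_int (Poly_Mapping.lookup Q k)" for k
  have v: "v \<in> Poly_Mapping.keys Q" using assms(1) by (simp add: selects_def)
  obtain c' where c': "\<And>l. laurent_expansion P Q v l \<noteq> 0 \<Longrightarrow> c' \<le> idot a l"
    using laurent_expansion_bounded_below[OF assms(1)] by blast
  define b where "b = min c c'"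
  have h0: "(\<Sum>k\<in>Poly_Mapping.keys Q. q k * h (l - k)) = 0" for l
    using assms(2)[of l] laurent_expansion_times[OF assms(1), of P l]
    by (simp add: h_def q_def right_diff_distrib sum_subtractf)
  have vanish: "h l = 0" if "idot a l < b + int N" for N l
    using that
  proof (induction N arbitrary: l)
    case 0
    then have "f l = 0" "laurent_expansion P Q v l = 0"
      using assms(3)[of l] c'[of l] by (auto simp: b_def)
    then show ?case by (simp add: h_def)
  next
    case (Suc N)
    \<comment> \<open>The recurrence is read at \<open>l + v\<close>, where the term
      \<open>k = v\<close> is \<open>h l\<close> and all others lie on lower levels.\<close>
    have "h (l + v - k) = 0" if "k \<in> Poly_Mapping.keys Q - {v}" for k
    proof (rule Suc.IH)
      have "idot a (k - v) > 0" using assms(1) that by (simp add: selects_def)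
      then show "idot a (l + v - k) < b + int N" using Suc.prems by (simp add: idot_add idot_diff)
    qed
    then have "(\<Sum>k\<in>Poly_Mapping.keys Q. q k * h (l + v - k)) = q v * h l"
      using v by (simp add: sum.remove[of _ v])
    then have "q v * h l = 0" using h0 by simp
    then show ?case using v by (simp add: q_def in_keys_iff)
  qed
  have "h l = 0" for l by (rule vanish[of l "nat (idot a l - b + 1)"]) simp
  then show ?thesis by (simp add: h_def fun_eq_iff)
qed

text \<open>Shifting by a negated integer multiplies by that power of \<open>t\<close>, which places
  the monomial in degree \<open>idot a k\<close>.\<close>

definition graded_monom :: "int ^ 'v \<Rightarrow> int ^ 'v \<Rightarrow> rat \<Rightarrow> 'v::finite lseries" where
  "graded_monom a k c = fls_shift (- idot a k) (fls_const (Poly_Mapping.single k c))"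

lemma graded_monom_nth: "graded_monom a k c $$ n = (if n = idot a k then Poly_Mapping.single k c else 0)"
  by (simp add: graded_monom_def)

lemma ser_coeff_monom_mult: "ser_coeff (graded_monom a k c * x) n l = c * ser_coeff x (n - idot a k) (l - k)"
  by (simp add: graded_monom_def ser_coeff_def fls_shifted_times_simps mult.commute[of "Poly_Mapping.single k c"]
      lookup_times[of "{k}"])

lemma graded_monom_mult: "graded_monom a k c * graded_monom a l d = graded_monom a (k + l) (c * d)"
  by (simp add: graded_monom_def fls_shifted_times_simps mult_single idot_add add.commute)

lemma graded_monom_0_1 [simp]: "graded_monom a 0 1 = 1"
  by (simp add: graded_monom_def)

lemma graded_monom_power: "graded_monom a k 1 ^ m = graded_monom a (int m *s k) 1"
proof (induction m)
  case (Suc m)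
  have "k + int m *s k = int (Suc m) *s k" by (simp add: vec_eq_iff algebra_simps)
  then show ?case by (simp add: Suc.IH graded_monom_mult)
qed simp

lemma frob_monom: "p > 0 \<Longrightarrow> frob p (graded_monom a k c) = graded_monom a (int p *s k) c"
  by (rule frob_eqI) (auto simp: graded_monom_nth idot_scale pm_frob_single)

lemma graded_monom_of_int: "graded_monom a k (of_int m) = of_int m * graded_monom a k 1"
  by (simp add: graded_monom_def fls_of_int fls_shifted_times_simps mult_single flip: single_of_int)

text \<open>For coefficient 1 the \<open>p\<close>-th power equals the \<open>frob\<close> image
  exactly; integer coefficients follow by repeated addition and negation.\<close>

lemma frob_lift_monom:
  assumes p: "prime p"
  shows "frob_lift p (graded_monom a k (of_int m))"
proof -
  have p0: "p > 0" using p prime_gt_0_nat by blast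
  have "pdiv p 0 (graded_monom a k 1)"
    using p by (simp add: pdiv_def ser_coeff_def graded_monom_nth lookup_single when_def)
  then have "frob_lift p (graded_monom a k 1)"
    using p p0 by (simp add: frob_lift_def frob_monom graded_monom_power)
  then show ?thesis by (simp add: graded_monom_of_int[of _ _ m] frob_lift_of_int_mult[OF p])
qed

definition graded :: "int ^ 'v \<Rightarrow> (int, 'v) laurent_poly \<Rightarrow> 'v::finite lseries" where
  "graded a Q = (\<Sum>k\<in>Poly_Mapping.keys Q. graded_monom a k (of_int (Poly_Mapping.lookup Q k)))"

lemma frob_lift_graded: "prime p \<Longrightarrow> frob_lift p (graded a Q)"
  unfolding graded_def by (intro frob_lift_sum frob_lift_monom)

lemma ser_coeff_graded_mult:
  "ser_coeff (graded a Q * x) n l =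
    (\<Sum>k\<in>Poly_Mapping.keys Q. rat_of_int (Poly_Mapping.lookup Q k) * ser_coeff x (n - idot a k) (l - k))"
  by (simp add: graded_def sum_distrib_right ser_coeff_sum ser_coeff_monom_mult)

definition graded_series :: "int ^ 'v \<Rightarrow> 'v laurent_series \<Rightarrow> 'v::finite lseries" where
  "graded_series a f = Abs_fls (\<lambda>n. \<Sum>l | f l \<noteq> 0 \<and> idot a l = n. Poly_Mapping.single l (f l))"

lemma ser_coeff_graded_series:
  assumes "\<And>c. finite {l. f l \<noteq> 0 \<and> idot a l \<le> c}"
  shows "ser_coeff (graded_series a f) n l = (if idot a l = n then f l else 0)"
proof -
  have fin: "finite {l. f l \<noteq> 0 \<and> idot a l = n}" for n
    by (rule finite_subset[OF _ assms[of n]]) auto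
  \<comment> \<open>Only finitely many exponents of the support have degree at most 0, which gives
    the lower bound needed for \<open>Abs_fls\<close>.\<close>
  define b where "b = - (\<Sum>l | f l \<noteq> 0 \<and> idot a l \<le> 0. \<bar>idot a l\<bar>)"
  have "b \<le> idot a l" if "f l \<noteq> 0" for l
  proof (cases "idot a l \<le> 0")
    case True
    then have "\<bar>idot a l\<bar> \<le> (\<Sum>l | f l \<noteq> 0 \<and> idot a l \<le> 0. \<bar>idot a l\<bar>)"
      using that assms by (intro member_le_sum) auto
    then show ?thesis by (simp add: b_def)
  next
    case False
    moreover have "b \<le> 0" unfolding b_def neg_le_0_iff_le by (rule sum_nonneg) simp
    ultimately show ?thesis by simp
  qed
  then have "(\<Sum>l | f l \<noteq> 0 \<and> idot a l = n. Poly_Mapping.single l (f l)) = 0" if "n < b" for n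
    using that by (intro sum.neutral) fastforce
  then have "graded_series a f $$ n = (\<Sum>l | f l \<noteq> 0 \<and> idot a l = n. Poly_Mapping.single l (f l))"
    unfolding graded_series_def by (intro nth_Abs_fls_ex_lower_bound exI[of _ b] allI impI) simp
  then show ?thesis
    using fin by (auto simp: ser_coeff_def lookup_sum lookup_single when_def sum.delta)
qed

text \<open>\<open>inverse_expansion Q v\<close> belongs to the quotient of the monomial with
  exponent \<open>v\<close> by \<open>Q\<close>; the shift by \<open>v\<close> leaves the plain
  inverse of \<open>Q\<close>.\<close>

definition graded_inverse :: "int ^ 'v \<Rightarrow> (int, 'v) laurent_poly \<Rightarrow> int ^ 'v \<Rightarrow> 'v::finite lseries" where
  "graded_inverse a Q v = graded_series a (\<lambda>l. inverse_expansion Q v (l + v))"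

lemma ser_coeff_graded_inverse:
  assumes "selects a Q v"
  shows "ser_coeff (graded_inverse a Q v) n l = (if idot a l = n then inverse_expansion Q v (l + v) else 0)"
  unfolding graded_inverse_def
proof (rule ser_coeff_graded_series)
  fix c
  have "{l. inverse_expansion Q v (l + v) \<noteq> 0 \<and> idot a l \<le> c} =
      (\<lambda>l. l - v) ` {l. inverse_expansion Q v l \<noteq> 0 \<and> idot a l \<le> c + idot a v}" (is "?L = ?R")
  proof (intro equalityI subsetI)
    fix l assume "l \<in> ?L"
    then show "l \<in> ?R" by (intro image_eqI[of _ _ "l + v"]) (auto simp: idot_add)
  qed (auto simp: idot_diff)
  then show "finite {l. inverse_expansion Q v (l + v) \<noteq> 0 \<and> idot a l \<le> c}"
    using inverse_expansion_bounded[OF assms] by simp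
qed

lemma graded_graded_inverse:
  assumes "selects a Q v"
  shows "graded a Q * graded_inverse a Q v = 1"
proof -
  have "ser_coeff (graded a Q * graded_inverse a Q v) n l = ser_coeff 1 n l" for n l
  proof -
    have "ser_coeff (graded a Q * graded_inverse a Q v) n l = (\<Sum>k\<in>Poly_Mapping.keys Q.
        rat_of_int (Poly_Mapping.lookup Q k) * (if idot a l = n then inverse_expansion Q v (l - (k - v)) else 0))"
      by (simp add: ser_coeff_graded_mult ser_coeff_graded_inverse[OF assms] idot_diff algebra_simps cong: if_cong)
    also have "\<dots> = (if idot a l = n then if l = 0 then 1 else 0 else 0)"
      by (simp add: inverse_expansion_recurrence[OF selects_newton_vertex[OF assms]])
    finally show ?thesis by (auto simp: ser_coeff_1)
  qed
  then show ?thesis by (auto simp: ser_coeff_def intro!: fls_eqI poly_mapping_eqI)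
qed

lemma ser_coeff_graded_graded_inverse:
  assumes "selects a Q v"
  shows "ser_coeff (graded a P * graded_inverse a Q v) n l = (if idot a l = n then laurent_expansion P Q v l else 0)"
  by (simp add: ser_coeff_graded_mult ser_coeff_graded_inverse[OF assms] laurent_expansion_def idot_diff algebra_simps)

lemma pdiv_graded_inverse:
  assumes "prime p" "selects a Q v" "\<not> int p dvd Poly_Mapping.lookup Q v"
  shows "pdiv p 0 (graded_inverse a Q v)"
  using assms by (simp add: pdiv_def ser_coeff_graded_inverse p_integral_inverse_expansion)

text \<open>Coefficients live only where \<open>n = idot a l\<close>, a condition that scaling by
  \<open>p ^ r\<close> preserves and reflects. The extra grading therefore does not alter the
  congruences.\<close>

lemma gauss_graded_graded_inverse:
  assumes p: "prime p" and "selects a Q v"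
  shows "gauss_series p (graded a P * graded_inverse a Q v) \<longleftrightarrow> gauss_congruences p (laurent_expansion P Q v)"
proof -
  define f where "f = laurent_expansion P Q v"
  have c: "ser_coeff (graded a P * graded_inverse a Q v) n l = (if idot a l = n then f l else 0)" for n l
    using ser_coeff_graded_graded_inverse[OF assms(2)] by (simp add: f_def)
  have scale: "ser_coeff (graded a P * graded_inverse a Q v) (int (p ^ r) * n) (int (p ^ r) *s l) =
      (if idot a l = n then f (int (p ^ r) *s l) else 0)" for r n l
    using p prime_gt_0_nat[OF p] by (simp add: c idot_scale)
  show ?thesis unfolding f_def[symmetric]
  proof
    assume g: "gauss_series p (graded a P * graded_inverse a Q v)"
    show "gauss_congruences p f"
      unfolding gauss_congruences_def
    proof (intro conjI allI impI)
      fix k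
      show "p_integral p (f k)"
        using g[unfolded gauss_series_def pdiv_def, THEN conjunct1, rule_format, of "idot a k" k] by (simp add: c)
    next
      fix m and r :: nat assume "1 \<le> r"
      then obtain s where r: "r = Suc s" by (cases r) auto
      show "p_integral p ((f (int (p ^ r) *s m) - f (int (p ^ (r - 1)) *s m)) / of_nat (p ^ r))"
        using g[unfolded gauss_series_def, THEN conjunct2, rule_format, of s "idot a m" m]
        by (simp only: scale r diff_Suc_1 if_True simp_thms)
    qed
  next
    assume g: "gauss_congruences p f"
    show "gauss_series p (graded a P * graded_inverse a Q v)"
      unfolding gauss_series_def
    proof (intro conjI allI)
      show "pdiv p 0 (graded a P * graded_inverse a Q v)"
        using g p by (simp add: pdiv_def c gauss_congruences_def)
    next
      fix r n l
      have "p_integral p ((f (int (p ^ Suc r) *s l) - f (int (p ^ (Suc r - 1)) *s l)) / of_nat (p ^ Suc r))"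
        using g unfolding gauss_congruences_def by (metis le_add1 plus_1_eq_Suc)
      then show "p_integral p ((ser_coeff (graded a P * graded_inverse a Q v) (int (p ^ Suc r) * n) (int (p ^ Suc r) *s l)
        - ser_coeff (graded a P * graded_inverse a Q v) (int (p ^ r) * n) (int (p ^ r) *s l)) / of_nat (p ^ Suc r))"
        using p by (simp only: scale diff_Suc_1) simp
    qed
  qed
qed

section \<open>Multilinear denominators\<close>

definition subpoly :: "'b set \<Rightarrow> ('b \<Rightarrow>\<^sub>0 'a::comm_monoid_add) \<Rightarrow> 'b \<Rightarrow>\<^sub>0 'a" where
  "subpoly S Q = (\<Sum>k\<in>Poly_Mapping.keys Q \<inter> S. Poly_Mapping.single k (Poly_Mapping.lookup Q k))"

lemma lookup_subpoly: "Poly_Mapping.lookup (subpoly S Q) k = (if k \<in> S then Poly_Mapping.lookup Q k else 0)"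
  by (auto simp: subpoly_def lookup_sum lookup_single when_def sum.delta in_keys_iff)

lemma keys_subpoly [simp]: "Poly_Mapping.keys (subpoly S Q) = Poly_Mapping.keys Q \<inter> S"
  by (auto simp: in_keys_iff lookup_subpoly split: if_splits)

lemma subpoly_subpoly: "subpoly S (subpoly T Q) = subpoly (S \<inter> T) Q"
  by (rule poly_mapping_eqI) (simp add: lookup_subpoly)

lemma subpoly_cong: "Poly_Mapping.keys Q \<inter> S = Poly_Mapping.keys Q \<inter> T \<Longrightarrow> subpoly S Q = subpoly T Q"
  by (simp add: subpoly_def)

lemma subpoly_id: "Poly_Mapping.keys Q \<subseteq> S \<Longrightarrow> subpoly S Q = Q"
  by (rule poly_mapping_eqI) (auto simp: lookup_subpoly in_keys_iff)

lemma graded_subpoly: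
  "graded a (subpoly S Q) = (\<Sum>k\<in>Poly_Mapping.keys Q \<inter> S. graded_monom a k (of_int (Poly_Mapping.lookup Q k)))"
  by (simp add: graded_def lookup_subpoly)

lemma graded_split: "graded a Q = graded a (subpoly S Q) + graded a (subpoly (- S) Q)"
  unfolding graded_subpoly graded_def[of a Q] Diff_eq[symmetric] by (rule sum.Int_Diff) simp

lemma selects_subpoly: "selects a Q v \<Longrightarrow> v \<in> S \<Longrightarrow> selects a (subpoly S Q) v"
  by (auto simp: selects_def)

text \<open>With \<open>W\<close> the negated quotient of the part of \<open>Q\<close> off
  \<open>S\<close> by the part on \<open>S\<close>, the factor multiplying \<open>G\<close> is the
  inverse of \<open>1 - W\<close>, and \<open>gauss_times_geometric\<close> applies.\<close>

lemma gauss_factor: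
  assumes p: "prime p" and v: "selects a Q v" and ndvd: "\<not> int p dvd Poly_Mapping.lookup Q v"
    and S: "S = {k. k $ i = v $ i}" and \<epsilon>: "\<bar>\<epsilon>\<bar> = 1"
    and Q2: "\<And>k. k \<in> Poly_Mapping.keys Q \<Longrightarrow> k \<notin> S \<Longrightarrow> k $ i = v $ i + \<epsilon>"
    and "gauss_series p G" and G: "\<And>n l. ser_coeff G n l \<noteq> 0 \<Longrightarrow> l $ i = 0"
  shows "gauss_series p (G * (graded a (subpoly S Q) * graded_inverse a Q v))"
proof (rule gauss_times_geometric[OF p assms(7) _ G _ \<epsilon>])
  define Q1 where "Q1 = graded a (subpoly S Q)"
  define J where "J = graded_inverse a (subpoly S Q) v"
  define W where "W = - (graded a (subpoly (- S) Q) * J)"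
  have v1: "selects a (subpoly S Q) v" using v S by (intro selects_subpoly) auto
  have QJ: "Q1 * J = 1" unfolding Q1_def J_def by (rule graded_graded_inverse[OF v1])
  have "pdiv p 0 J"
    unfolding J_def using S ndvd by (intro pdiv_graded_inverse[OF p v1]) (simp add: lookup_subpoly)
  then have "frob_lift p J"
    by (intro frob_lift_inverse[OF p _ QJ]) (simp_all add: Q1_def frob_lift_graded p)
  then show "frob_lift p W"
    unfolding W_def by (intro frob_lift_uminus frob_lift_mult frob_lift_graded p)
  have "1 - W = Q1 * J + graded a (subpoly (- S) Q) * J" by (simp add: QJ W_def)
  also have "\<dots> = J * graded a Q" by (simp add: graded_split[of a Q S] Q1_def distrib_left mult.commute)
  finally have "Q1 * graded_inverse a Q v * (1 - W) = (Q1 * J) * (graded a Q * graded_inverse a Q v)"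
    by (simp add: ac_simps)
  then show "graded a (subpoly S Q) * graded_inverse a Q v * (1 - W) = 1"
    using QJ graded_graded_inverse[OF v] by (simp add: Q1_def)
  fix n l assume "ser_coeff W n l \<noteq> 0"
  then have "idot a l = n" "laurent_expansion (subpoly (- S) Q) (subpoly S Q) v l \<noteq> 0"
    by (auto simp: W_def J_def ser_coeff_uminus ser_coeff_graded_graded_inverse[OF v1] split: if_splits)
  then obtain k where "k \<in> Poly_Mapping.keys (subpoly (- S) Q)"
    and "inverse_expansion (subpoly S Q) v (l - (k - v)) \<noteq> 0"
    by (metis laurent_expansion_nonzeroE)
  then have k: "k \<in> Poly_Mapping.keys Q" "k \<notin> S"
    "inverse_expansion (subpoly S Q) v (l - (k - v)) \<noteq> 0" by auto
  \<comment> \<open>The inverse of the part on \<open>S\<close> does not involve variable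
    \<open>i\<close>, so the degree of \<open>W\<close> in it comes from \<open>k - v\<close>
    alone.\<close>
  have "l - (k - v) \<in> {l. l $ i = 0}"
    by (rule inverse_expansion_support[OF _ _ _ k(3)]) (auto simp: S)
  then have "l $ i = \<epsilon>" using Q2[OF k(1,2)] by simp
  moreover have "idot a l - idot a (k - v) \<ge> 0"
    using inverse_expansion_nonneg[OF v1 k(3)] by (simp only: idot_diff)
  moreover have "idot a (k - v) > 0" using v k(1,2) S by (auto simp: selects_def)
  ultimately show "l $ i = \<epsilon> \<and> n \<ge> 1" using \<open>idot a l = n\<close> by simp
qed

text \<open>Induction on the number of terms of \<open>Q\<close>, from the slice of \<open>Q\<close>
  matching \<open>K\<close> on \<open>I\<close> up to all of \<open>Q\<close>. Genericity of
  \<open>a\<close> ensures that this one functional also selects a vertex of each intermediate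
  subpolynomial.\<close>

lemma gauss_multilinear:
  assumes p: "prime p"
    and P: "\<And>k i. k \<in> Poly_Mapping.keys P \<Longrightarrow> i \<in> I \<Longrightarrow> k $ i = K $ i"
    and "\<And>k l. k \<in> Poly_Mapping.keys Q \<Longrightarrow> l \<in> Poly_Mapping.keys Q \<Longrightarrow> k \<noteq> l \<Longrightarrow> idot a (k - l) \<noteq> 0"
    and "\<And>k. k \<in> Poly_Mapping.keys Q \<Longrightarrow> \<not> int p dvd Poly_Mapping.lookup Q k"
    and "\<And>k i. k \<in> Poly_Mapping.keys Q \<Longrightarrow> i \<in> I \<Longrightarrow> k $ i \<in> {0, 1}"
    and "selects a (subpoly {k. \<forall>i\<in>I. k $ i = K $ i} Q) w"
    and "gauss_series p (graded a P * graded_inverse a (subpoly {k. \<forall>i\<in>I. k $ i = K $ i} Q) w)"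
    and "selects a Q v"
  shows "gauss_series p (graded a P * graded_inverse a Q v)"
  using assms(3-)
proof (induction "card (Poly_Mapping.keys Q)" arbitrary: Q v rule: less_induct)
  case less
  define F where "F = {k. \<forall>i\<in>I. k $ i = K $ i}"
  note generic = less.prems(1) and ndvd = less.prems(2) and binary = less.prems(3)
    and w = less.prems(4)[folded F_def] and base = less.prems(5)[folded F_def] and v = less.prems(6)
  have wF: "w \<in> Poly_Mapping.keys Q" "w \<in> F" using w by (auto simp: selects_def)
  show ?case
  proof (cases "Poly_Mapping.keys Q \<subseteq> F")
    case True
    then have Q: "subpoly F Q = Q" by (rule subpoly_id)
    have "w = v"
    proof (rule ccontr)
      assume "w \<noteq> v"
      then have "idot a (w - v) > 0" "idot a (v - w) > 0"
        using w v unfolding Q by (auto simp: selects_def)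
      then show False by (simp add: idot_diff)
    qed
    then show ?thesis using base unfolding Q by simp
  next
    case False
    then obtain \<kappa> i where \<kappa>: "\<kappa> \<in> Poly_Mapping.keys Q" "i \<in> I" "\<kappa> $ i \<noteq> K $ i"
      by (auto simp: F_def)
    define T where "T = {k. k $ i = K $ i}"
    \<comment> \<open>Passing from \<open>Q\<close> to \<open>subpoly T Q\<close> leaves the slice
      \<open>F\<close>, and hence the hypothesis on it, unchanged.\<close>
    have FT: "F \<inter> T = F" using \<kappa>(2) by (auto simp: F_def T_def)
    have "Poly_Mapping.keys (subpoly T Q) \<noteq> {}" using wF \<kappa>(2) by (auto simp: F_def T_def)
    then have "subpoly T Q \<noteq> 0" by (metis keys_zero)
    then obtain u where u: "selects a (subpoly T Q) u"
      using selects_ex[of "subpoly T Q" a] generic by auto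
    have "Poly_Mapping.keys (subpoly T Q) \<subset> Poly_Mapping.keys Q" using \<kappa> by (auto simp: T_def)
    then have "card (Poly_Mapping.keys (subpoly T Q)) < card (Poly_Mapping.keys Q)"
      by (intro psubset_card_mono) auto
    then have G: "gauss_series p (graded a P * graded_inverse a (subpoly T Q) u)"
      by (rule less.hyps) (use generic ndvd binary w base u in
        \<open>auto simp: lookup_subpoly subpoly_subpoly FT simp flip: F_def\<close>)
    have G0: "l $ i = 0" if "ser_coeff (graded a P * graded_inverse a (subpoly T Q) u) n l \<noteq> 0" for n l
    proof -
      have "laurent_expansion P (subpoly T Q) u l \<noteq> 0"
        using that by (simp add: ser_coeff_graded_graded_inverse[OF u] split: if_splits)
      then obtain k where k: "k \<in> Poly_Mapping.keys P" "inverse_expansion (subpoly T Q) u (l - (k - u)) \<noteq> 0"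
        by (rule laurent_expansion_nonzeroE)
      have uT: "u $ i = K $ i" using u by (auto simp: selects_def T_def)
      have "l - (k - u) \<in> {l. l $ i = 0}"
        by (rule inverse_expansion_support[OF _ _ _ k(2)]) (auto simp: T_def uT)
      then show "l $ i = 0" using P[OF k(1) \<kappa>(2)] uT by simp
    qed
    define S where "S = {k. k $ i = v $ i}"
    have vQ: "v \<in> Poly_Mapping.keys Q" using v by (simp add: selects_def)
    \<comment> \<open>The step from the layer of \<open>v\<close> to the other layer: 1 if
      \<open>v $ i\<close> is 0, and -1 if it is 1.\<close>
    define \<epsilon> where "\<epsilon> = 1 - 2 * v $ i"
    have \<epsilon>: "\<bar>\<epsilon>\<bar> = 1" using binary[OF vQ \<kappa>(2)] by (auto simp: \<epsilon>_def)
    have other: "k $ i = v $ i + \<epsilon>" if "k \<in> Poly_Mapping.keys Q" "k \<notin> S" for k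
      using binary[OF vQ \<kappa>(2)] binary[OF that(1) \<kappa>(2)] that(2) by (auto simp: S_def \<epsilon>_def)
    have GY: "gauss_series p (graded a P * graded_inverse a (subpoly T Q) u *
        (graded a (subpoly S Q) * graded_inverse a Q v))"
      by (rule gauss_factor[OF p v _ S_def \<epsilon> other G G0]) (use ndvd vQ in auto)
    show ?thesis
    proof (cases "v $ i = K $ i")
      case True
      then have "S = T" by (simp add: S_def T_def)
      \<comment> \<open>The vertex lies in the layer of \<open>P\<close>, and the factor from
        \<open>subpoly T Q\<close> cancels.\<close>
      have "graded a P * graded_inverse a (subpoly T Q) u * (graded a (subpoly T Q) * graded_inverse a Q v) =
          graded a P * graded_inverse a Q v * (graded a (subpoly T Q) * graded_inverse a (subpoly T Q) u)"
        by (simp only: ac_simps)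
      then show ?thesis using GY graded_graded_inverse[OF u] by (simp add: \<open>S = T\<close>)
    next
      case False
      have "v $ i \<in> {0, 1}" "K $ i \<in> {0, 1}"
        using binary[OF vQ \<kappa>(2)] binary[OF wF(1) \<kappa>(2)] wF(2) \<kappa>(2) by (auto simp: F_def)
      then have "k \<in> S \<longleftrightarrow> k \<in> - T" if "k \<in> Poly_Mapping.keys Q" for k
        using False binary[OF that \<kappa>(2)] by (auto simp: S_def T_def)
      \<comment> \<open>The vertex lies in the layer opposite to \<open>P\<close>. Subtracting the
        known product from the quotient of \<open>P\<close> by \<open>subpoly T Q\<close> leaves the
        quotient of \<open>P\<close> by \<open>Q\<close>.\<close>
      then have "subpoly S Q = subpoly (- T) Q" by (intro subpoly_cong) blast
      then have eq: "graded a (subpoly S Q) = graded a Q - graded a (subpoly T Q)"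
        by (simp add: graded_split[of a Q T])
      have "graded a P * graded_inverse a (subpoly T Q) u
          - graded a P * graded_inverse a (subpoly T Q) u * (graded a (subpoly S Q) * graded_inverse a Q v)
        = graded a P * graded_inverse a (subpoly T Q) u
          - graded a P * graded_inverse a (subpoly T Q) u * (graded a Q * graded_inverse a Q v)
          + graded a P * graded_inverse a Q v * (graded a (subpoly T Q) * graded_inverse a (subpoly T Q) u)"
        unfolding eq by (simp add: algebra_simps)
      also have "\<dots> = graded a P * graded_inverse a Q v"
        using graded_graded_inverse[OF u] graded_graded_inverse[OF v] by simp
      finally show ?thesis using gauss_diff[OF p G GY] by simp
    qed
  qed
qed

section \<open>The variables \<open>z\<close> and \<open>x\<^sub>1, \<dots>, x\<^sub>n\<close>\<close>

lemma finite_primes_dvd: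
  assumes "c \<noteq> 0"
  shows "finite {p. prime p \<and> int p dvd c}"
proof (rule finite_subset)
  show "{p. prime p \<and> int p dvd c} \<subseteq> {..nat \<bar>c\<bar>}"
  proof
    fix p assume "p \<in> {p. prime p \<and> int p dvd c}"
    then have "\<bar>int p\<bar> \<le> \<bar>c\<bar>" using assms dvd_imp_le_int by blast
    then show "p \<in> {..nat \<bar>c\<bar>}" by simp
  qed
qed simp

text \<open>Such a prime divides the numerator of \<open>c\<close>.\<close>

lemma finite_primes_p_integral_divide:
  assumes "c \<noteq> 0"
  shows "finite {p. prime p \<and> p_integral p (c / of_nat p)}"
proof -
  obtain A B where AB: "c = rat_of_int A / rat_of_int B" "B \<noteq> 0"
    using quotient_of_div[of c] quotient_of_denom_pos'[of c] by (metis less_irrefl prod.collapse)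
  have "int p dvd A" if p: "prime p" and int: "p_integral p (c / of_nat p)" for p
  proof -
    obtain a b where ab: "c / of_nat p = rat_of_int a / rat_of_int b" "\<not> int p dvd b"
      using int p_integral_iff[OF p] by blast
    have "b \<noteq> 0" "p > 0" using ab(2) p prime_gt_0_nat by auto
    then have "rat_of_int (A * b) = rat_of_int (int p * a * B)"
      using ab(1) AB by (simp add: field_simps)
    then have "A * b = int p * (a * B)" by (simp only: of_int_eq_iff mult.assoc)
    then have "int p dvd A * b" by simp
    then show ?thesis using ab(2) p by (simp add: prime_dvd_mult_iff)
  qed
  moreover have "A \<noteq> 0" using assms AB by auto
  ultimately show ?thesis by (auto intro: finite_subset[OF _ finite_primes_dvd[of A]])
qed

section \<open>Splitting exponents into their parts in \<open>x\<close> and in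
  \<open>z\<close>\<close>

lemma zx_exponent_None [simp]: "zx_exponent k j $ None = j $ 1"
  and zx_exponent_Some [simp]: "zx_exponent k j $ Some i = k $ i"
  by (simp_all add: zx_exponent_def)

definition x_part :: "int ^ ('n::finite) option \<Rightarrow> int ^ 'n" where
  "x_part l = (\<chi> i. l $ Some i)"

definition z_part :: "int ^ ('n::finite) option \<Rightarrow> int ^ 1" where
  "z_part l = (\<chi> _. l $ None)"

lemma vec_option_eq_iff: "l = m \<longleftrightarrow> l $ None = m $ None \<and> (\<forall>i. l $ Some i = m $ Some i)"
  for l m :: "int ^ ('n::finite) option"
  by (metis option.exhaust vec_eq_iff)

lemma x_part_nth [simp]: "x_part l $ i = l $ Some i"
  by (simp add: x_part_def)

lemma zx_parts [simp]:
  "zx_exponent (x_part l) (z_part l) = l" "x_part (zx_exponent k j) = k" "z_part (zx_exponent k j) = j"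
  by (simp_all add: vec_option_eq_iff z_part_def vec_eq_iff)

lemma x_part_diff: "x_part (l - m) = x_part l - x_part m"
  and x_part_scale: "x_part (d *s l) = d *s x_part l"
  and z_part_diff: "z_part (l - m) = z_part l - z_part m"
  and z_part_scale: "z_part (d *s l) = d *s z_part l"
  by (simp_all add: x_part_def z_part_def vec_eq_iff)

lemma zx_exponent_diff: "zx_exponent k i - zx_exponent l j = zx_exponent (k - l) (i - j)"
  and zx_exponent_scale: "d *s zx_exponent k j = zx_exponent (d *s k) (d *s j)"
  by (simp_all add: vec_option_eq_iff)

lemma zx_exponent_inject [simp]: "zx_exponent k i = zx_exponent l j \<longleftrightarrow> k = l \<and> i = j"
  by (metis zx_parts(2,3))

lemma keys_x_coeff: "j \<in> Poly_Mapping.keys (x_coeff P k) \<longleftrightarrow> zx_exponent k j \<in> Poly_Mapping.keys P"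
  by (simp add: in_keys_iff lookup_x_coeff)

lemma x_coeff_nonzero_iff: "x_coeff P k \<noteq> 0 \<longleftrightarrow> (\<exists>l\<in>Poly_Mapping.keys P. x_part l = k)"
proof -
  have "x_coeff P k \<noteq> 0 \<longleftrightarrow> (\<exists>j. j \<in> Poly_Mapping.keys (x_coeff P k))"
    by (metis ex_in_conv keys_eq_empty)
  also have "\<dots> \<longleftrightarrow> (\<exists>l\<in>Poly_Mapping.keys P. x_part l = k)"
    unfolding keys_x_coeff by (metis zx_parts(1,2))
  finally show ?thesis .
qed

lemma idot_option:
  "idot a l = a $ None * l $ None + (\<Sum>i\<in>UNIV. a $ Some i * l $ Some i)"
  by (simp add: idot_def UNIV_option_conv sum.reindex)

lemma idot_1: "idot c j = c $ 1 * j $ 1" for c j :: "int ^ 1"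
  by (simp add: idot_def UNIV_1)

text \<open>Exponents over the same \<open>k\<close> differ only in \<open>z\<close>, so only the
  \<open>z\<close> component of \<open>a\<close> matters there.\<close>

lemma selects_x_coeff:
  assumes "selects a Q (zx_exponent k v)"
  shows "selects (z_part a) (x_coeff Q k) v"
proof -
  have eq: "idot (z_part a) (j - v) = idot a (zx_exponent k j - zx_exponent k v)" for j
    by (simp add: zx_exponent_diff idot_option idot_1 z_part_def)
  show ?thesis
    unfolding selects_def eq
  proof (intro conjI ballI)
    fix j assume "j \<in> Poly_Mapping.keys (x_coeff Q k) - {v}"
    then have "zx_exponent k j \<in> Poly_Mapping.keys Q - {zx_exponent k v}" by (simp add: keys_x_coeff)
    then show "idot a (zx_exponent k j - zx_exponent k v) > 0" using assms unfolding selects_def by blast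
  qed (use assms in \<open>simp add: selects_def keys_x_coeff\<close>)
qed

lemma sum_keys_x_part:
  "(\<Sum>l\<in>Poly_Mapping.keys Q \<inter> {l. x_part l = k}. f l) =
    (\<Sum>j\<in>Poly_Mapping.keys (x_coeff Q k). f (zx_exponent k j))"
proof (rule sum.reindex_bij_witness[of _ "zx_exponent k" z_part])
  fix l assume "l \<in> Poly_Mapping.keys Q \<inter> {l. x_part l = k}"
  then show "zx_exponent k (z_part l) = l" "z_part l \<in> Poly_Mapping.keys (x_coeff Q k)"
    by (auto simp: keys_x_coeff)
qed (auto simp: keys_x_coeff)

text \<open>The common monomial in \<open>x\<close> with exponent \<open>k\<close> cancels, leaving
  a series of degree 0 in \<open>x\<close>. The univariate expansion extended by zero solves the
  recurrence, and uniqueness identifies the two.\<close>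

lemma laurent_expansion_slice:
  fixes P Q :: "(int, ('n::finite) option) laurent_poly" and k :: "int ^ 'n"
  defines "R \<equiv> \<lambda>P. subpoly {l. x_part l = k} P"
  assumes v: "selects a (R Q) (zx_exponent k v)"
  shows "laurent_expansion (R P) (R Q) (zx_exponent k v) =
    (\<lambda>l. if x_part l = 0 then laurent_expansion (x_coeff P k) (x_coeff Q k) v (z_part l) else 0)"
proof -
  define g where "g = laurent_expansion (x_coeff P k) (x_coeff Q k) v"
  define f where "f l = (if x_part l = 0 then g (z_part l) else 0)" for l :: "int ^ 'n option"
  have "x_coeff (R Q) k = x_coeff Q k"
    by (rule poly_mapping_eqI) (simp add: lookup_x_coeff R_def lookup_subpoly)
  then have v1: "selects (z_part a) (x_coeff Q k) v" using selects_x_coeff[OF v] by simp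
  obtain c where c: "\<And>j. g j \<noteq> 0 \<Longrightarrow> c \<le> idot (z_part a) j"
    unfolding g_def using laurent_expansion_bounded_below[OF v1] by blast
  have "f = laurent_expansion (R P) (R Q) (zx_exponent k v)"
  proof (rule laurent_expansion_unique[OF v])
    fix l
    have "(\<Sum>\<kappa>\<in>Poly_Mapping.keys (R Q). rat_of_int (Poly_Mapping.lookup (R Q) \<kappa>) * f (l - \<kappa>)) =
        (\<Sum>j\<in>Poly_Mapping.keys (x_coeff Q k).
          rat_of_int (Poly_Mapping.lookup (x_coeff Q k) j) * f (l - zx_exponent k j))"
      by (simp add: R_def sum_keys_x_part lookup_subpoly lookup_x_coeff)
    also have "\<dots> = rat_of_int (Poly_Mapping.lookup (R P) l)"
      using laurent_expansion_times[OF v1, of "x_coeff P k" "z_part l"]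
      by (auto simp: f_def x_part_diff z_part_diff R_def lookup_subpoly lookup_x_coeff g_def)
    finally show "(\<Sum>\<kappa>\<in>Poly_Mapping.keys (R Q). rat_of_int (Poly_Mapping.lookup (R Q) \<kappa>) * f (l - \<kappa>))
      = rat_of_int (Poly_Mapping.lookup (R P) l)" .
    assume "f l \<noteq> 0"
    then have "x_part l = 0" "c \<le> idot (z_part a) (z_part l)" using c by (auto simp: f_def split: if_splits)
    then show "c \<le> idot a l"
      by (simp add: idot_option idot_1 z_part_def vec_eq_iff)
  qed
  moreover have "f = (\<lambda>l. if x_part l = 0 then laurent_expansion (x_coeff P k) (x_coeff Q k) v (z_part l) else 0)"
    by (simp add: f_def g_def fun_eq_iff)
  ultimately show ?thesis by simp
qed

text \<open>For \<open>k\<close> in the unit cube, this functional attains its minimum over the cube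
  only at \<open>k\<close>. Its zero in the \<open>z\<close> direction makes everything over
  \<open>k\<close> one face.\<close>

definition face_normal :: "int ^ 'n \<Rightarrow> int ^ ('n::finite) option" where
  "face_normal k = (\<chi> i. case i of None \<Rightarrow> 0 | Some j \<Rightarrow> if k $ j = 0 then 1 else - 1)"

text \<open>Every coordinate contributes nonnegatively: where \<open>w\<close> is positive, it is at
  least 1 and so at least \<open>\<kappa>\<close>. Only \<open>\<kappa>\<close> is bounded by 1,
  since \<open>w\<close> will also be an exponent of \<open>P\<close>.\<close>

lemma idot_face_normal:
  fixes \<kappa> w :: "int ^ ('n::finite) option"
  assumes "\<And>i. 0 \<le> w $ Some i" "\<And>i. 0 \<le> \<kappa> $ Some i" "\<And>i. \<kappa> $ Some i \<le> 1"
  shows "idot (face_normal (x_part w)) (\<kappa> - w) \<ge> 0"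
    and "x_part \<kappa> \<noteq> x_part w \<Longrightarrow> idot (face_normal (x_part w)) (\<kappa> - w) > 0"
proof -
  define t where "t i = (if w $ Some i = 0 then 1 else - 1) * (\<kappa> $ Some i - w $ Some i)" for i
  have sum: "idot (face_normal (x_part w)) (\<kappa> - w) = sum t UNIV"
    by (simp add: idot_option face_normal_def t_def)
  have t: "t i \<ge> 0" for i
    using assms(1)[of i] assms(2)[of i] assms(3)[of i] by (auto simp: t_def)
  then show "idot (face_normal (x_part w)) (\<kappa> - w) \<ge> 0" by (simp add: sum sum_nonneg)
  assume "x_part \<kappa> \<noteq> x_part w"
  then obtain i where "\<kappa> $ Some i \<noteq> w $ Some i" by (auto simp: vec_eq_iff)
  then have "t i > 0" using t[of i] by (auto simp: t_def split: if_splits)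
  then show "idot (face_normal (x_part w)) (\<kappa> - w) > 0"
    unfolding sum using t by (intro sum_pos2[of _ i]) auto
qed

text \<open>In the recurrence at 0 every term but \<open>k = v\<close> sits in negative degree and
  vanishes.\<close>

lemma inverse_expansion_0:
  assumes "selects a Q v"
  shows "inverse_expansion Q v 0 = 1 / rat_of_int (Poly_Mapping.lookup Q v)"
proof -
  have v: "v \<in> Poly_Mapping.keys Q" using assms by (simp add: selects_def)
  have "inverse_expansion Q v (0 - (k - v)) = 0" if "k \<in> Poly_Mapping.keys Q - {v}" for k
  proof (rule ccontr)
    assume "inverse_expansion Q v (0 - (k - v)) \<noteq> 0"
    from inverse_expansion_nonneg[OF assms this] have "idot a (k - v) \<le> 0"
      by (simp add: idot_diff)
    moreover have "idot a (k - v) > 0" using assms that unfolding selects_def by blast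
    ultimately show False by simp
  qed
  then have "rat_of_int (Poly_Mapping.lookup Q v) * inverse_expansion Q v 0 = 1"
    using inverse_expansion_recurrence[OF selects_newton_vertex[OF assms], of 0] v
    by (simp add: sum.remove[of _ v])
  then show ?thesis using v by (simp add: in_keys_iff field_simps)
qed

text \<open>Otherwise the lowest term of the expansion lies at some \<open>u\<close> with \<open>a \<bullet> u < 0\<close>, and then
  \<open>p u\<close> is outside the support for every \<open>p \<ge> 2\<close>.\<close>

lemma gauss_property_minimum:
  assumes "gauss_property P Q" "selects a Q v" "selects a P w"
  shows "idot a w \<ge> idot a v"
proof (rule ccontr)
  assume neg: "\<not> idot a w \<ge> idot a v"
  define f where "f = laurent_expansion P Q v"
  define u where "u = w - v"
  have v: "v \<in> Poly_Mapping.keys Q" and w: "w \<in> Poly_Mapping.keys P"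
    using assms by (simp_all add: selects_def)
  have supp: "idot a u \<le> idot a l" if nz: "f l \<noteq> 0" for l
  proof -
    obtain k where k: "k \<in> Poly_Mapping.keys P" "inverse_expansion Q v (l - (k - v)) \<noteq> 0"
      using nz unfolding f_def by (rule laurent_expansion_nonzeroE)
    have "idot a w \<le> idot a k" using assms(3) k(1) by (cases "k = w") (auto simp: selects_def idot_diff less_imp_le)
    moreover have "idot a l - (idot a k - idot a v) \<ge> 0"
      using inverse_expansion_nonneg[OF assms(2) k(2)] by (simp only: idot_diff)
    ultimately show ?thesis by (simp add: u_def idot_diff)
  qed
  \<comment> \<open>Only the lowest term of \<open>P\<close> reaches \<open>u\<close>, so the
    coefficient there is a single nonzero product.\<close>
  have "inverse_expansion Q v (u - (k - v)) = 0" if "k \<in> Poly_Mapping.keys P - {w}" for k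
  proof (rule ccontr)
    assume "inverse_expansion Q v (u - (k - v)) \<noteq> 0"
    from inverse_expansion_nonneg[OF assms(2) this] have "idot a (k - w) \<le> 0"
      by (simp add: idot_diff u_def)
    moreover have "idot a (k - w) > 0" using assms(3) that unfolding selects_def by blast
    ultimately show False by simp
  qed
  then have "f u = rat_of_int (Poly_Mapping.lookup P w) * inverse_expansion Q v 0"
    using w by (simp add: f_def laurent_expansion_def sum.remove[of _ w] u_def)
  then have fu: "f u \<noteq> 0"
    using v w by (simp add: inverse_expansion_0[OF assms(2)] in_keys_iff)
  have "gauss_congruences p f \<Longrightarrow> p_integral p (- f u / of_nat p)" if p: "prime p" for p
  proof -
    assume "gauss_congruences p f"
    then have "p_integral p ((f (int (p ^ 1) *s u) - f (int (p ^ (1 - 1)) *s u)) / of_nat (p ^ 1))"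
      unfolding gauss_congruences_def by blast
    moreover have "f (int p *s u) = 0"
    proof (rule ccontr)
      assume "f (int p *s u) \<noteq> 0"
      then have "idot a u \<le> int p * idot a u" using supp by (simp flip: idot_scale)
      moreover have "int p * idot a u < 1 * idot a u"
        using neg prime_gt_1_nat[OF p] by (intro mult_strict_right_mono_neg) (auto simp: u_def idot_diff)
      ultimately show False by simp
    qed
    ultimately show "p_integral p (- f u / of_nat p)" by simp
  qed
  \<comment> \<open>Both sets on the right are finite, against the infinitude of primes.\<close>
  then have "{p. prime p} \<subseteq> {p. prime p \<and> \<not> gauss_congruences p f} \<union>
      {p. prime p \<and> p_integral p (- f u / of_nat p)}" by blast
  moreover have "finite {p. prime p \<and> \<not> gauss_congruences p f}"
    using assms(1) selects_newton_vertex[OF assms(2)]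
    by (simp add: gauss_property_def series_gauss_property_def f_def)
  moreover have "finite {p. prime p \<and> p_integral p (- f u / of_nat p)}"
    using fu by (intro finite_primes_p_integral_divide) simp
  ultimately have "finite {p::nat. prime p}" using finite_subset by blast
  then show False using primes_infinite by simp
qed

section \<open>The two directions of the equivalence\<close>

context
  fixes P Q :: "(int, ('n::finite) option) laurent_poly"
  assumes P: "is_polynomial P" and Q: "is_polynomial Q" "Q \<noteq> 0" and linear: "linear_in_x Q"
begin

private lemma Q_01: "\<kappa> \<in> Poly_Mapping.keys Q \<Longrightarrow> 0 \<le> \<kappa> $ Some i \<and> \<kappa> $ Some i \<le> 1"
  using Q(1) linear by (simp add: is_polynomial_def linear_in_x_def)

private lemma P_0: "\<kappa> \<in> Poly_Mapping.keys P \<Longrightarrow> 0 \<le> \<kappa> $ i"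
  using P by (simp add: is_polynomial_def)

text \<open>If \<open>k\<close> does not occur in \<open>Q\<close>, the face normal at
  \<open>k\<close> places a term of \<open>P\<close> strictly below all terms of \<open>Q\<close>. A
  generic perturbation then contradicts \<open>gauss_property_minimum\<close>.\<close>

lemma gauss_property_imp_x_support:
  assumes "gauss_property P Q" "x_coeff P k \<noteq> 0"
  shows "x_coeff Q k \<noteq> 0"
proof (rule ccontr)
  assume "\<not> x_coeff Q k \<noteq> 0"
  then have notin: "x_part \<kappa> \<noteq> k" if "\<kappa> \<in> Poly_Mapping.keys Q" for \<kappa>
    using that x_coeff_nonzero_iff[of Q k] by blast
  obtain w where w: "w \<in> Poly_Mapping.keys P" "x_part w = k"
    using assms(2) x_coeff_nonzero_iff by blast
  define D where "D = (\<lambda>\<kappa>. \<kappa> - w) ` Poly_Mapping.keys Q"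
  \<comment> \<open>The perturbed functional must have a unique minimum on the support of
    \<open>P\<close> as well as on that of \<open>Q\<close>.\<close>
  define X where "X = (\<lambda>(x, y). x - y) `
    ((Poly_Mapping.keys P \<union> Poly_Mapping.keys Q) \<times> (Poly_Mapping.keys P \<union> Poly_Mapping.keys Q))"
  have "\<forall>d\<in>D. idot (face_normal k) d > 0"
    using idot_face_normal(2)[of w] P_0[OF w(1)] Q_01 notin w(2) by (auto simp: D_def)
  then obtain a where a: "\<forall>d\<in>D. idot a d > 0" "\<forall>x\<in>X. x \<noteq> 0 \<longrightarrow> idot a x \<noteq> 0"
    using idot_generic[of X D "face_normal k"] by (auto simp: X_def D_def)
  have generic: "idot a (x - y) \<noteq> 0"
    if "x \<in> Poly_Mapping.keys P \<union> Poly_Mapping.keys Q" "y \<in> Poly_Mapping.keys P \<union> Poly_Mapping.keys Q" "x \<noteq> y" for x y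
  proof -
    have "x - y \<in> X" unfolding X_def using that by (intro image_eqI[of _ _ "(x, y)"]) auto
    then show ?thesis using a(2) that(3) by simp
  qed
  obtain v where v: "selects a Q v" using selects_ex[OF Q(2), of a] generic by blast
  have "P \<noteq> 0" using w(1) by auto
  then obtain u where u: "selects a P u" using selects_ex[of P a] generic by blast
  have "idot a u \<le> idot a w"
    using u w(1) by (cases "u = w") (auto simp: selects_def idot_diff less_imp_le)
  moreover have "idot a w < idot a v" using a(1) v by (auto simp: D_def selects_def idot_diff)
  ultimately show False using gauss_property_minimum[OF assms(1) v u] by simp
qed

text \<open>The terms of \<open>Q\<close> over \<open>k\<close> form a face, so a vertex of the
  coefficient gives a vertex \<open>V\<close> of \<open>Q\<close>. The part of the expansion at
  \<open>V\<close> of degree 0 in \<open>x\<close> solves the univariate recurrence.\<close>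

lemma gauss_property_imp_x_coeff:
  assumes "gauss_property P Q" "x_coeff Q k \<noteq> 0"
  shows "gauss_property (x_coeff P k) (x_coeff Q k)"
  unfolding gauss_property_def
proof (intro allI impI)
  fix v assume "newton_vertex v (x_coeff Q k)"
  then obtain c where c: "selects c (x_coeff Q k) v" using newton_vertex_selects by blast
  define V where "V = zx_exponent k v"
  have VQ: "V \<in> Poly_Mapping.keys Q" using c by (simp add: V_def selects_def keys_x_coeff)
  have xV: "x_part V = k" by (simp add: V_def)
  \<comment> \<open>Weighted by \<open>M\<close>, the face normal outweighs every contribution from
    \<open>z\<close> off the face; on the face \<open>c\<close> alone decides.\<close>
  define M where "M = 1 + (\<Sum>\<kappa>\<in>Poly_Mapping.keys Q. \<bar>c $ 1 * (\<kappa> $ None - v $ 1)\<bar>)"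
  define a where "a = M *s face_normal k + zx_exponent 0 c"
  have a: "idot a l = M * idot (face_normal k) l + c $ 1 * l $ None" for l
    by (simp add: a_def idot_add_left idot_scale_left idot_option[of "zx_exponent 0 c"])
  have normal: "0 \<le> idot (face_normal k) (\<kappa> - V)" "x_part \<kappa> \<noteq> k \<Longrightarrow> 0 < idot (face_normal k) (\<kappa> - V)"
    if "\<kappa> \<in> Poly_Mapping.keys Q" for \<kappa>
    using idot_face_normal[of V \<kappa>, unfolded xV] Q_01[OF that] Q_01[OF VQ] by simp_all
  have V: "selects a Q V"
    unfolding selects_def
  proof (intro conjI ballI VQ)
    fix \<kappa> assume \<kappa>: "\<kappa> \<in> Poly_Mapping.keys Q - {V}"
    show "0 < idot a (\<kappa> - V)"
    proof (cases "x_part \<kappa> = k")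
      case True
      then obtain j where j: "\<kappa> = zx_exponent k j" by (metis zx_parts(1))
      then have "j \<in> Poly_Mapping.keys (x_coeff Q k) - {v}" using \<kappa> by (auto simp: keys_x_coeff V_def)
      then have "idot c (j - v) > 0" using c by (simp add: selects_def)
      moreover have "idot (face_normal k) (\<kappa> - V) = 0"
        by (simp add: j V_def idot_option face_normal_def)
      ultimately show ?thesis by (simp add: a j V_def idot_1)
    next
      case False
      have M: "\<bar>c $ 1 * (\<kappa> $ None - v $ 1)\<bar> < M"
      proof -
        have "\<bar>c $ 1 * (\<kappa> $ None - v $ 1)\<bar> \<le> (\<Sum>\<kappa>\<in>Poly_Mapping.keys Q. \<bar>c $ 1 * (\<kappa> $ None - v $ 1)\<bar>)"
          using \<kappa> by (intro member_le_sum) auto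
        then show ?thesis by (simp add: M_def)
      qed
      have "idot (face_normal k) (\<kappa> - V) \<ge> 1" using normal(2) \<kappa> False by fastforce
      then have "M * 1 \<le> M * idot (face_normal k) (\<kappa> - V)" using M by (intro mult_left_mono) linarith+
      moreover have "(\<kappa> - V) $ None = \<kappa> $ None - v $ 1" by (simp add: V_def)
      ultimately show ?thesis using M unfolding a by (simp only: mult_1_right)
    qed
  qed
  define f where "f = laurent_expansion P Q V"
  \<comment> \<open>This uses the support condition just proved: the exponents of \<open>P\<close>
    in \<open>x\<close> occur in \<open>Q\<close> and hence lie in the unit cube.\<close>
  have supp: "idot (face_normal k) l \<ge> 0" if nz: "f l \<noteq> 0" for l
  proof -
    obtain \<mu> where \<mu>: "\<mu> \<in> Poly_Mapping.keys P" "inverse_expansion Q V (l - (\<mu> - V)) \<noteq> 0"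
      using nz unfolding f_def by (rule laurent_expansion_nonzeroE)
    have "l - (\<mu> - V) \<in> {l. idot (face_normal k) l \<ge> 0}"
      by (rule inverse_expansion_support[OF _ _ _ \<mu>(2)]) (use normal(1) in \<open>auto simp: idot_add\<close>)
    moreover have "x_coeff Q (x_part \<mu>) \<noteq> 0"
      using gauss_property_imp_x_support[OF assms(1)] \<mu>(1) x_coeff_nonzero_iff by blast
    then obtain \<kappa> where "\<kappa> \<in> Poly_Mapping.keys Q" "x_part \<kappa> = x_part \<mu>"
      using x_coeff_nonzero_iff by blast
    then have "0 \<le> \<mu> $ Some i \<and> \<mu> $ Some i \<le> 1" for i
      using Q_01[of \<kappa> i] by (metis x_part_nth)
    then have "idot (face_normal k) (\<mu> - V) \<ge> 0"
      using idot_face_normal(1)[of V \<mu>, unfolded xV] Q_01[OF VQ] by simp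
    ultimately show ?thesis by (simp add: idot_diff)
  qed
  define g where "g j = f (zx_exponent 0 j)" for j
  obtain b where b: "\<And>l. f l \<noteq> 0 \<Longrightarrow> b \<le> idot a l"
    unfolding f_def using laurent_expansion_bounded_below[OF V] by blast
  have "g = laurent_expansion (x_coeff P k) (x_coeff Q k) v"
  proof (rule laurent_expansion_unique[OF c])
    fix j
    \<comment> \<open>Off the face the argument leaves the half-space supporting \<open>f\<close>,
      so the recurrence for \<open>Q\<close> reduces to the one for its coefficient at
      \<open>k\<close>.\<close>
    have "f (zx_exponent k j - \<kappa>) = 0" if "\<kappa> \<in> Poly_Mapping.keys Q" "x_part \<kappa> \<noteq> k" for \<kappa>
    proof (rule ccontr)
      assume "f (zx_exponent k j - \<kappa>) \<noteq> 0"
      moreover have "idot (face_normal k) (zx_exponent k j) = idot (face_normal k) V"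
        by (simp add: V_def idot_option face_normal_def)
      ultimately have "idot (face_normal k) (\<kappa> - V) \<le> 0"
        using supp by (fastforce simp: idot_diff)
      then show False using normal(2)[OF that] by simp
    qed
    then have "(\<Sum>\<kappa>\<in>Poly_Mapping.keys Q. rat_of_int (Poly_Mapping.lookup Q \<kappa>) * f (zx_exponent k j - \<kappa>)) =
        (\<Sum>\<kappa>\<in>Poly_Mapping.keys Q \<inter> {\<kappa>. x_part \<kappa> = k}. rat_of_int (Poly_Mapping.lookup Q \<kappa>) * f (zx_exponent k j - \<kappa>))"
      by (intro sum.mono_neutral_right) auto
    also have "\<dots> = (\<Sum>i\<in>Poly_Mapping.keys (x_coeff Q k).
        rat_of_int (Poly_Mapping.lookup (x_coeff Q k) i) * g (j - i))"
      by (simp add: sum_keys_x_part lookup_x_coeff g_def zx_exponent_diff)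
    finally show "(\<Sum>i\<in>Poly_Mapping.keys (x_coeff Q k).
        rat_of_int (Poly_Mapping.lookup (x_coeff Q k) i) * g (j - i)) =
        rat_of_int (Poly_Mapping.lookup (x_coeff P k) j)"
      using laurent_expansion_times[OF V, of P "zx_exponent k j"] by (simp add: f_def lookup_x_coeff)
    assume "g j \<noteq> 0"
    then have "b \<le> idot a (zx_exponent 0 j)" unfolding g_def by (rule b)
    then show "b \<le> idot c j" unfolding a by (simp add: idot_1 idot_option face_normal_def)
  qed
  moreover have "gauss_congruences p g" if "gauss_congruences p f" for p
    using that unfolding gauss_congruences_def g_def
    by (metis zx_exponent_scale vector_smult_rzero)
  then have "series_gauss_property g"
    using assms(1) selects_newton_vertex[OF V] unfolding gauss_property_def series_gauss_property_def f_def
    by (metis (mono_tags, lifting) Collect_mono finite_subset)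
  ultimately show "series_gauss_property (laurent_expansion (x_coeff P k) (x_coeff Q k) v)" by simp
qed

text \<open>Split \<open>P\<close> by its exponents in \<open>x\<close>. For each,
  \<open>gauss_multilinear\<close> lifts the congruences from the univariate quotient at a vertex
  selected by the same generic functional; the slices are then added.\<close>

lemma gauss_property_if_x_coeff:
  assumes support: "\<And>k. x_coeff P k \<noteq> 0 \<Longrightarrow> x_coeff Q k \<noteq> 0"
    and univariate: "\<And>k. x_coeff Q k \<noteq> 0 \<Longrightarrow> gauss_property (x_coeff P k) (x_coeff Q k)"
  shows "gauss_property P Q"
  unfolding gauss_property_def series_gauss_property_def
proof (intro allI impI)
  fix v assume "newton_vertex v Q"
  then obtain b where b: "selects b Q v" using newton_vertex_selects by blast
  define D where "D = (\<lambda>\<kappa>. \<kappa> - v) ` (Poly_Mapping.keys Q - {v})"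
  define X where "X = (\<lambda>(x, y). x - y) ` (Poly_Mapping.keys Q \<times> Poly_Mapping.keys Q)"
  have "\<forall>d\<in>D. idot b d > 0" using b by (simp add: D_def selects_def)
  then obtain a where a: "\<forall>d\<in>D. idot a d > 0" "\<forall>x\<in>X. x \<noteq> 0 \<longrightarrow> idot a x \<noteq> 0"
    using idot_generic[of X D b] by (auto simp: X_def D_def)
  have generic: "idot a (x - y) \<noteq> 0"
    if "x \<in> Poly_Mapping.keys Q" "y \<in> Poly_Mapping.keys Q" "x \<noteq> y" for x y
  proof -
    have "x - y \<in> X" unfolding X_def using that by (intro image_eqI[of _ _ "(x, y)"]) auto
    then show ?thesis using a(2) that(3) by simp
  qed
  have v: "selects a Q v" using a(1) b by (simp add: D_def selects_def)
  define R where "R k P = subpoly {l. x_part l = k} P" for k and P :: "(int, 'n option) laurent_poly"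
  define K where "K = x_part ` Poly_Mapping.keys P"
  have "\<exists>u. selects a (R k Q) (zx_exponent k u)" if "k \<in> K" for k
  proof -
    have "x_coeff P k \<noteq> 0" using that x_coeff_nonzero_iff by (auto simp: K_def)
    then obtain \<kappa> where "\<kappa> \<in> Poly_Mapping.keys Q" "x_part \<kappa> = k" using support x_coeff_nonzero_iff by blast
    then have "Poly_Mapping.keys (R k Q) \<noteq> {}" by (auto simp: R_def)
    then have "R k Q \<noteq> 0" by (metis keys_zero)
    then obtain w where w: "selects a (R k Q) w"
      using selects_ex[of "R k Q" a] generic by (auto simp: R_def)
    then have "x_part w = k" by (simp add: selects_def R_def)
    then show ?thesis using w by (metis zx_parts(1))
  qed
  then obtain u where u: "\<And>k. k \<in> K \<Longrightarrow> selects a (R k Q) (zx_exponent k (u k))" by metis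
  define g where "g k = laurent_expansion (x_coeff P k) (x_coeff Q k) (u k)" for k
  \<comment> \<open>Every coefficient of \<open>Q\<close> must be prime to \<open>p\<close>, because
    the induction divides by vertex coefficients of subpolynomials.\<close>
  define bad where "bad = (\<Union>\<kappa>\<in>Poly_Mapping.keys Q. {p. prime p \<and> int p dvd Poly_Mapping.lookup Q \<kappa>})
      \<union> (\<Union>k\<in>K. {p. prime p \<and> \<not> gauss_congruences p (g k)})"
  have "finite {p. prime p \<and> \<not> gauss_congruences p (g k)}" if "k \<in> K" for k
  proof -
    have "x_coeff (R k Q) k = x_coeff Q k"
      by (rule poly_mapping_eqI) (simp add: lookup_x_coeff R_def lookup_subpoly)
    then have "newton_vertex (u k) (x_coeff Q k)"
      using selects_newton_vertex[OF selects_x_coeff[OF u[OF that]]] by simp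
    moreover have "x_coeff Q k \<noteq> 0"
      using that support x_coeff_nonzero_iff[of P k] by (auto simp: K_def)
    ultimately show ?thesis
      using univariate by (simp add: gauss_property_def series_gauss_property_def g_def)
  qed
  then have "finite bad"
    unfolding bad_def by (auto simp: K_def in_keys_iff intro!: finite_primes_dvd)
  moreover have "gauss_congruences p (laurent_expansion P Q v)" if p: "prime p" and "p \<notin> bad" for p
  proof -
    have slice: "gauss_series p (graded a (R k P) * graded_inverse a Q v)" if k: "k \<in> K" for k
    proof (rule gauss_multilinear[OF p, where I = "range Some" and K = "zx_exponent k 0"])
      have eq: "{l. \<forall>i\<in>range Some. l $ i = zx_exponent k 0 $ i} = {l. x_part l = k}"
        by (auto simp: vec_eq_iff)
      note uk = u[OF k]
      show "selects a (subpoly {l. \<forall>i\<in>range Some. l $ i = zx_exponent k 0 $ i} Q) (zx_exponent k (u k))"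
        unfolding eq using uk by (simp add: R_def)
      have g: "gauss_congruences p (g k)" using p \<open>p \<notin> bad\<close> k by (auto simp: bad_def)
      \<comment> \<open>Scaling by a power of \<open>p\<close> does not change whether the
        \<open>x\<close> part is 0, so extension by zero keeps the congruences.\<close>
      have "gauss_congruences p (\<lambda>l. if x_part l = 0 then g k (z_part l) else 0)"
        unfolding gauss_congruences_def
      proof (intro conjI allI impI)
        fix l show "p_integral p (if x_part l = 0 then g k (z_part l) else 0)"
          using g p by (simp add: gauss_congruences_def)
      next
        fix m and r :: nat assume "1 \<le> r"
        then have "p_integral p ((g k (int (p ^ r) *s z_part m) - g k (int (p ^ (r - 1)) *s z_part m)) / of_nat (p ^ r))"
          using g unfolding gauss_congruences_def by blast
        then show "p_integral p (((if x_part (int (p ^ r) *s m) = 0 then g k (z_part (int (p ^ r) *s m)) else 0)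
          - (if x_part (int (p ^ (r - 1)) *s m) = 0 then g k (z_part (int (p ^ (r - 1)) *s m)) else 0)) / of_nat (p ^ r))"
          using p prime_gt_0_nat[OF p] by (cases "x_part m = 0") (simp_all add: x_part_scale z_part_scale)
      qed
      then have "gauss_congruences p (laurent_expansion (R k P) (R k Q) (zx_exponent k (u k)))"
        unfolding R_def laurent_expansion_slice[OF uk[unfolded R_def]] g_def .
      then show "gauss_series p (graded a (R k P) *
          graded_inverse a (subpoly {l. \<forall>i\<in>range Some. l $ i = zx_exponent k 0 $ i} Q) (zx_exponent k (u k)))"
        unfolding eq using gauss_graded_graded_inverse[OF p uk] by (simp add: R_def)
      show "\<not> int p dvd Poly_Mapping.lookup Q \<kappa>" if "\<kappa> \<in> Poly_Mapping.keys Q" for \<kappa>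
        using that p \<open>p \<notin> bad\<close> by (auto simp: bad_def)
      show "\<kappa> $ i \<in> {0, 1}" if \<kappa>: "\<kappa> \<in> Poly_Mapping.keys Q" and i: "i \<in> range Some" for \<kappa> i
      proof -
        obtain j where "i = Some j" using i by blast
        then show ?thesis using Q_01[OF \<kappa>, of j] by auto
      qed
      show "\<kappa> $ i = zx_exponent k 0 $ i" if "\<kappa> \<in> Poly_Mapping.keys (R k P)" "i \<in> range Some" for \<kappa> i
        using that by (auto simp: R_def)
    qed (use generic v in auto)
    have "graded a P = (\<Sum>k\<in>K. graded a (R k P))"
    proof -
      have "graded a (R k P) =
          (\<Sum>l | l \<in> Poly_Mapping.keys P \<and> x_part l = k. graded_monom a l (of_int (Poly_Mapping.lookup P l)))" for k
        by (simp add: R_def graded_subpoly Int_def)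
      then show ?thesis unfolding K_def graded_def[of a P] by (simp only: sum.image_gen[OF finite_keys])
    qed
    then have "graded a P * graded_inverse a Q v = (\<Sum>k\<in>K. graded a (R k P) * graded_inverse a Q v)"
      by (simp add: sum_distrib_right)
    also have "gauss_series p \<dots>" using slice by (intro gauss_sum[OF p])
    finally show ?thesis using gauss_graded_graded_inverse[OF p v] by blast
  qed
  then have "{p. prime p \<and> \<not> gauss_congruences p (laurent_expansion P Q v)} \<subseteq> bad" by blast
  ultimately show "finite {p. prime p \<and> \<not> gauss_congruences p (laurent_expansion P Q v)}"
    using finite_subset by blast
qed

end

theorem theorem5p4:
  fixes P Q :: "(int, ('n::finite) option) laurent_poly"
  assumes "is_polynomial P" and "is_polynomial Q" and "Q \<noteq> 0"
    and "linear_in_x Q"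
  shows "gauss_property P Q \<longleftrightarrow>
    (\<forall>k. x_coeff P k \<noteq> 0 \<longrightarrow> x_coeff Q k \<noteq> 0) \<and>
    (\<forall>k. x_coeff Q k \<noteq> 0 \<longrightarrow> gauss_property (x_coeff P k) (x_coeff Q k))"
  using gauss_property_imp_x_support[OF assms] gauss_property_imp_x_coeff[OF assms]
    gauss_property_if_x_coeff[OF assms] by blast

end
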